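(* Let $d\ge1$, $a,\alpha\in\mathbb{R}^d$ and $b,\beta\in\mathbb{R}$. Let $\Omega_S:=Q(0,a,b)$ and $\Omega_F:=Q(0,\alpha,\beta)$, and suppose that $\mathbf{1}_{\Omega_S},\mathbf{1}_{\Omega_F}\in L^2(\mathbb{R}^d)$. Let $\mathcal{K}$ be the concentration operator associated to the masks $m_S=\mathbf{1}_{\Omega_S}$ and $\widehat{m_F}=\mathbf{1}_{\Omega_F}$. Then there exists a second-order differential operator $\mathcal{P}$, self-adjoint on $L^2(\Omega_S)$, which commutes with the concentration operator $\mathcal{K}$ (i.e. $\mathcal{P}\mathcal{K}=\mathcal{K}\mathcal{P}$). It is given by $$\mathcal{P}(x,\nabla_x)=\nabla_x\cdot(\mathbf{A}(x)\nabla_x)+C(x),$$ where $$\mathbf{A}(x):=\mathrm{diag}\Big\{\alpha_m\Big(\sum_{n=1}^d a_nx_n^2-b\Big)\Big\}_{m=1}^d\quad\text{and}\quad C(x)=\beta\,x\cdot\mathrm{diag}\{a_n\}_{n=1}^d\,x .$$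
   Context: For $a,c\in\mathbb{R}^d$ and $b\in\mathbb{R}$, the quadratic domain is $Q(c,a,b):=\{x\in\mathbb{R}^d:\sum_{m=1}^d(x_m-c_m)^2a_m\le b\}$. For binary masks $m_S=\mathbf{1}_{\Omega_S}$ (in space) and $\widehat{m_F}=\mathbf{1}_{\Omega_F}$ (in Fourier), both in $L^2(\mathbb{R}^d)$, the concentration operator, regarded as acting on functions on $\Omega_S$, is $$(\mathcal{K}f)(x)=\int_{\Omega_S}k(x-y)f(y)\,dy,\quad x\in\Omega_S,\qquad k(z)=\frac{1}{(2\pi)^d}\int_{\Omega_F}e^{i\xi\cdot z}\,d\xi .$$ *)

theory Defs
  imports "HOL-Analysis.Analysis"
begin

definition quadratic_domain :: "real ^ 'd \<Rightarrow> real ^ 'd \<Rightarrow> real \<Rightarrow> (real ^ 'd) set" where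
  "quadratic_domain c a b = {x. (\<Sum>m\<in>UNIV. (x $ m - c $ m)\<^sup>2 * a $ m) \<le> b}"


(* Elements of L2 \<Omega> are functions on the whole space whose values off \<Omega> are irrelevant; they stand
   for their classes modulo equality almost everywhere on \<Omega>. *)

definition L2 :: "'a::euclidean_space set \<Rightarrow> ('a \<Rightarrow> complex) set" where
  "L2 \<Omega> = {f. f \<in> borel_measurable (lebesgue_on \<Omega>) \<and>
               integrable (lebesgue_on \<Omega>) (\<lambda>x. (cmod (f x))\<^sup>2)}"

definition L2_inner :: "'a::euclidean_space set \<Rightarrow> ('a \<Rightarrow> complex) \<Rightarrow> ('a \<Rightarrow> complex) \<Rightarrow> complex" where
  "L2_inner \<Omega> f g = (\<integral>x. f x * cnj (g x) \<partial>lebesgue_on \<Omega>)"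

definition L2_norm :: "'a::euclidean_space set \<Rightarrow> ('a \<Rightarrow> complex) \<Rightarrow> real" where
  "L2_norm \<Omega> f = sqrt (\<integral>x. (cmod (f x))\<^sup>2 \<partial>lebesgue_on \<Omega>)"

definition ae_eq :: "'a::euclidean_space set \<Rightarrow> ('a \<Rightarrow> complex) \<Rightarrow> ('a \<Rightarrow> complex) \<Rightarrow> bool" where
  "ae_eq \<Omega> f g \<longleftrightarrow> (AE x in lebesgue_on \<Omega>. f x = g x)"

type_synonym 'a graph = "(('a \<Rightarrow> complex) \<times> ('a \<Rightarrow> complex)) set"

(* A possibly unbounded linear operator in L2 \<Omega>, given by its graph: (f, g) \<in> T says that f lies in
   the domain of T and that g is a representative of T f. The second and third conjuncts say that T
   is a well-defined map on classes modulo equality almost everywhere. *)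
definition L2_operator :: "'a::euclidean_space set \<Rightarrow> 'a graph \<Rightarrow> bool" where
  "L2_operator \<Omega> T \<longleftrightarrow>
     T \<subseteq> L2 \<Omega> \<times> L2 \<Omega> \<and>
     (\<forall>(f, g) \<in> T. \<forall>f'\<in>L2 \<Omega>. \<forall>g'\<in>L2 \<Omega>. ae_eq \<Omega> f f' \<and> ae_eq \<Omega> g g' \<longrightarrow> (f', g') \<in> T) \<and>
     (\<forall>f g g'. (f, g) \<in> T \<and> (f, g') \<in> T \<longrightarrow> ae_eq \<Omega> g g') \<and>
     (\<lambda>x. 0, \<lambda>x. 0) \<in> T \<and>
     (\<forall>f g u v s t. (f, g) \<in> T \<and> (u, v) \<in> T \<longrightarrow>
        (\<lambda>x. s * f x + t * u x, \<lambda>x. s * g x + t * v x) \<in> T)"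

definition densely_defined :: "'a::euclidean_space set \<Rightarrow> 'a graph \<Rightarrow> bool" where
  "densely_defined \<Omega> T \<longleftrightarrow>
     (\<forall>f\<in>L2 \<Omega>. \<forall>e>0. \<exists>u\<in>Domain T. L2_norm \<Omega> (\<lambda>x. f x - u x) < e)"

definition adjoint_graph :: "'a::euclidean_space set \<Rightarrow> 'a graph \<Rightarrow> 'a graph" where
  "adjoint_graph \<Omega> T = {(g, h). g \<in> L2 \<Omega> \<and> h \<in> L2 \<Omega> \<and>
                          (\<forall>(u, v) \<in> T. L2_inner \<Omega> v g = L2_inner \<Omega> u h)}"

(* Equality of graphs: the domains of T and of its adjoint coincide, not merely symmetry of T. *)
definition self_adjoint :: "'a::euclidean_space set \<Rightarrow> 'a graph \<Rightarrow> bool" where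
  "self_adjoint \<Omega> T \<longleftrightarrow>
     L2_operator \<Omega> T \<and> densely_defined \<Omega> T \<and> adjoint_graph \<Omega> T = T"

(* K T \<subseteq> T K for an everywhere defined K: the domain of T is mapped into itself by K, and
   T (K f) = K (T f) for every f in the domain of T. *)
definition commutes_with :: "'a graph \<Rightarrow> (('a \<Rightarrow> complex) \<Rightarrow> ('a \<Rightarrow> complex)) \<Rightarrow> bool" where
  "commutes_with T K \<longleftrightarrow> (\<forall>(f, g) \<in> T. (K f, K g) \<in> T)"


definition partial_deriv :: "'d \<Rightarrow> (real ^ 'd \<Rightarrow> complex) \<Rightarrow> real ^ 'd \<Rightarrow> complex" where
  "partial_deriv m f x = frechet_derivative f (at x) (axis m 1)"

definition gradient :: "(real ^ 'd \<Rightarrow> complex) \<Rightarrow> real ^ 'd \<Rightarrow> complex ^ 'd" where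
  "gradient f x = (\<chi> m. partial_deriv m f x)"

definition divergence :: "(real ^ 'd \<Rightarrow> complex ^ 'd) \<Rightarrow> real ^ 'd \<Rightarrow> complex" where
  "divergence F x = (\<Sum>m\<in>UNIV. partial_deriv m (\<lambda>y. F y $ m) x)"

definition C2 :: "(real ^ 'd \<Rightarrow> complex) \<Rightarrow> bool" where
  "C2 f \<longleftrightarrow> f differentiable_on UNIV \<and>
     (\<forall>m. partial_deriv m f differentiable_on UNIV \<and>
       (\<forall>n. continuous_on UNIV (partial_deriv n (partial_deriv m f))))"

definition diag :: "'a::zero ^ 'd \<Rightarrow> 'a ^ 'd ^ 'd" where
  "diag v = (\<chi> i j. if i = j then v $ i else 0)"

definition divergence_form ::
    "(real ^ 'd \<Rightarrow> real ^ 'd ^ 'd) \<Rightarrow> (real ^ 'd \<Rightarrow> real) \<Rightarrow> (real ^ 'd \<Rightarrow> complex) \<Rightarrow> real ^ 'd \<Rightarrow> complex"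
  where
  "divergence_form A C f x =
     divergence (\<lambda>y. map_matrix of_real (A y) *v gradient f y) x + of_real (C x) * f x"

(* T is a realization in L2 \<Omega> of the differential expression with coefficients A and C: it acts
   classically on C2 functions up to the boundary of \<Omega>, with no boundary condition, and in the sense
   of distributions in the interior of \<Omega> on all of its domain. If T is moreover self-adjoint, it
   extends the minimal operator and is contained in the maximal operator of the expression. *)
definition realizes ::
    "(real ^ 'd) set \<Rightarrow> (real ^ 'd \<Rightarrow> real ^ 'd ^ 'd) \<Rightarrow> (real ^ 'd \<Rightarrow> real) \<Rightarrow> (real ^ 'd) graph \<Rightarrow> bool"
  where
  "realizes \<Omega> A C T \<longleftrightarrow>
     (\<forall>f. C2 f \<longrightarrow> (f, divergence_form A C f) \<in> T) \<and>
     (\<forall>(f, g) \<in> T. \<forall>\<phi>. C2 \<phi> \<and> compact (closure {x. \<phi> x \<noteq> 0}) \<and>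
          closure {x. \<phi> x \<noteq> 0} \<subseteq> interior \<Omega> \<longrightarrow>
        (\<integral>x. g x * \<phi> x \<partial>lebesgue_on \<Omega>) =
        (\<integral>x. f x * divergence_form (\<lambda>y. transpose (A y)) C \<phi> x \<partial>lebesgue_on \<Omega>))"


definition concentration_kernel :: "(real ^ 'd) set \<Rightarrow> real ^ 'd \<Rightarrow> complex" where
  "concentration_kernel \<Omega>F z =
     1 / of_real ((2 * pi) ^ CARD('d)) * (\<integral>\<xi>. exp (\<i> * of_real (\<xi> \<bullet> z)) \<partial>lebesgue_on \<Omega>F)"

definition concentration_operator ::
    "(real ^ 'd) set \<Rightarrow> (real ^ 'd) set \<Rightarrow> (real ^ 'd \<Rightarrow> complex) \<Rightarrow> real ^ 'd \<Rightarrow> complex" where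
  "concentration_operator \<Omega>S \<Omega>F f x =
     (\<integral>y. concentration_kernel \<Omega>F (x - y) * f y \<partial>lebesgue_on \<Omega>S)"

end

theory Submission
  imports Defs
begin

text \<open>A quadratic domain of finite measure is either null or a solid ellipsoid. On an ellipsoid
  \<open>\<Omega>\<close> the coefficient matrix vanishes on the boundary, so the divergence theorem makes the
  expression symmetric on C2 functions without boundary conditions. Its second-order part does
  not raise the degree of a polynomial; hence it restricts to symmetric maps of the
  finite-dimensional spaces of polynomials of bounded degree, whose union is dense in \<open>L2 \<Omega>\<close>.
  Compressing to these spaces by orthogonal projections shows that the adjoint of the expression on
  polynomials is symmetric, hence self-adjoint; the zeroth-order term is a bounded perturbation.

  For the commutation, the expression multiplies the plane wave \<open>exp (i \<xi> \<bullet> x)\<close> by a symbol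
  \<open>p \<xi> x\<close>, and \<open>(p \<xi> x - cnj (p \<xi> y)) * exp (i \<xi> \<bullet> (x - y))\<close> is a divergence in \<open>\<xi>\<close> of a field
  that vanishes on the boundary of the Fourier domain. So the expression acts in the same way on both
  variables of the kernel. Applied to superpositions of plane waves, and then of kernels, this gives
  commutation without differentiating under the integral sign.\<close>

section \<open>Square-integrable functions and symmetric graphs\<close>

text \<open>Self-adjointness asks for equality of two domains, yet the coefficients degenerate on
  the boundary of the space domain, and some \<open>\<alpha> $ m\<close> may vanish when the Fourier
  domain is null; elliptic regularity is not at hand to compare the domains. The finite-dimensional
  argument works for every \<open>\<alpha>\<close>. The realization is taken to be an adjoint, so
  membership means identities tested against polynomials; C2 functions and integrals over families
  of members then enter by inner products and Fubini.

  The commutation explains \<open>C\<close>. Let X and Y be the sums of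
  \<open>a $ n * (x $ n)\<^sup>2\<close> and \<open>a $ n * (y $ n)\<^sup>2\<close>. The real part
  of \<open>p \<xi> x - cnj (p \<xi> y)\<close> is X - Y times \<beta> minus the sum of
  \<open>\<alpha> $ m * (\<xi> $ m)\<^sup>2\<close>: \<open>b\<close> cancels, and the \<beta>
  contributed by \<open>C\<close> turns the coefficient into minus the defining function of the
  Fourier domain, which is zero on its boundary. Hence one divergence theorem serves twice: with (a,
  b) in space for symmetry, with (\<alpha>, \<beta>) in frequency for commutation.\<close>

lemma borel_measurable_cnj [measurable (raw)]:
  "f \<in> borel_measurable M \<Longrightarrow> (\<lambda>x. cnj (f x)) \<in> borel_measurable M"
  by (rule borel_measurable_continuous_on[where f = cnj]) (auto intro: continuous_intros)

lemma L2_D: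
  assumes "f \<in> L2 \<Omega>"
  shows "f \<in> borel_measurable (lebesgue_on \<Omega>)" "integrable (lebesgue_on \<Omega>) (\<lambda>x. (cmod (f x))\<^sup>2)"
  using assms by (auto simp: L2_def)

lemma L2_lincomb:
  assumes f: "f \<in> L2 \<Omega>" and g: "g \<in> L2 \<Omega>"
  shows "(\<lambda>x. s * f x + t * g x) \<in> L2 \<Omega>"
proof -
  note [measurable] = L2_D(1)[OF f] L2_D(1)[OF g]
  have "integrable (lebesgue_on \<Omega>) (\<lambda>x. (cmod (s * f x + t * g x))\<^sup>2)"
  proof (rule Bochner_Integration.integrable_bound)
    show "integrable (lebesgue_on \<Omega>)
        (\<lambda>x. 2 * (cmod s)\<^sup>2 * (cmod (f x))\<^sup>2 + 2 * (cmod t)\<^sup>2 * (cmod (g x))\<^sup>2)"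
      using L2_D(2)[OF f] L2_D(2)[OF g] by simp
    show "AE x in lebesgue_on \<Omega>. norm ((cmod (s * f x + t * g x))\<^sup>2)
       \<le> norm (2 * (cmod s)\<^sup>2 * (cmod (f x))\<^sup>2 + 2 * (cmod t)\<^sup>2 * (cmod (g x))\<^sup>2)"
    proof (rule AE_I2)
      fix x
      have "(cmod (s * f x + t * g x))\<^sup>2 \<le> (cmod s * cmod (f x) + cmod t * cmod (g x))\<^sup>2"
        by (intro power_mono) (auto simp: norm_mult[symmetric] norm_triangle_ineq)
      \<comment> \<open>The two sides differ by the square of
        \<open>cmod s * cmod (f x) - cmod t * cmod (g x)\<close>.\<close>
      also have "\<dots> \<le> 2 * (cmod s * cmod (f x))\<^sup>2 + 2 * (cmod t * cmod (g x))\<^sup>2"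
        using sum_squares_ge_zero[of "cmod s * cmod (f x) - cmod t * cmod (g x)" 0]
        by (simp add: power2_eq_square algebra_simps)
      finally show "norm ((cmod (s * f x + t * g x))\<^sup>2)
          \<le> norm (2 * (cmod s)\<^sup>2 * (cmod (f x))\<^sup>2 + 2 * (cmod t)\<^sup>2 * (cmod (g x))\<^sup>2)"
        by (simp add: power_mult_distrib mult.assoc)
    qed
  qed measurable
  then show ?thesis by (simp add: L2_def)
qed

lemma L2_zero [simp]: "(\<lambda>x. 0) \<in> L2 \<Omega>"
  by (simp add: L2_def)

lemma L2_diff: "f \<in> L2 \<Omega> \<Longrightarrow> g \<in> L2 \<Omega> \<Longrightarrow> (\<lambda>x. f x - g x) \<in> L2 \<Omega>"
  using L2_lincomb[of f \<Omega> g 1 "-1"] by simp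

lemma L2_add: "f \<in> L2 \<Omega> \<Longrightarrow> g \<in> L2 \<Omega> \<Longrightarrow> (\<lambda>x. f x + g x) \<in> L2 \<Omega>"
  using L2_lincomb[of f \<Omega> g 1 1] by simp

lemma L2_scale: "f \<in> L2 \<Omega> \<Longrightarrow> (\<lambda>x. c * f x) \<in> L2 \<Omega>"
  using L2_lincomb[of f \<Omega> f c 0] by simp

lemma L2_mult_bounded:
  assumes f: "f \<in> L2 \<Omega>" and c: "c \<in> borel_measurable (lebesgue_on \<Omega>)"
    and bd: "\<And>x. x \<in> \<Omega> \<Longrightarrow> cmod (c x) \<le> B"
  shows "(\<lambda>x. c x * f x) \<in> L2 \<Omega>"
proof -
  note [measurable] = L2_D(1)[OF f] c
  have "integrable (lebesgue_on \<Omega>) (\<lambda>x. (cmod (c x * f x))\<^sup>2)"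
  proof (rule Bochner_Integration.integrable_bound)
    show "integrable (lebesgue_on \<Omega>) (\<lambda>x. B\<^sup>2 * (cmod (f x))\<^sup>2)"
      using L2_D(2)[OF f] by simp
    show "AE x in lebesgue_on \<Omega>. norm ((cmod (c x * f x))\<^sup>2) \<le> norm (B\<^sup>2 * (cmod (f x))\<^sup>2)"
    proof (rule AE_I2)
      fix x assume "x \<in> space (lebesgue_on \<Omega>)"
      then have "cmod (c x) \<le> B" using bd by simp
      then have "(cmod (c x))\<^sup>2 \<le> B\<^sup>2" by (intro power_mono) auto
      then show "norm ((cmod (c x * f x))\<^sup>2) \<le> norm (B\<^sup>2 * (cmod (f x))\<^sup>2)"
        by (auto simp: norm_mult power_mult_distrib intro: mult_right_mono)
    qed
  qed measurable
  then show ?thesis by (simp add: L2_def)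
qed

lemma L2_inner_integrable:
  assumes f: "f \<in> L2 \<Omega>" and g: "g \<in> L2 \<Omega>"
  shows "integrable (lebesgue_on \<Omega>) (\<lambda>x. f x * cnj (g x))"
proof (rule Bochner_Integration.integrable_bound)
  note [measurable] = L2_D(1)[OF f] L2_D(1)[OF g]
  show "(\<lambda>x. f x * cnj (g x)) \<in> borel_measurable (lebesgue_on \<Omega>)" by measurable
  show "integrable (lebesgue_on \<Omega>) (\<lambda>x. (cmod (f x))\<^sup>2 + (cmod (g x))\<^sup>2)"
    using L2_D(2)[OF f] L2_D(2)[OF g] by simp
  show "AE x in lebesgue_on \<Omega>. norm (f x * cnj (g x)) \<le> norm ((cmod (f x))\<^sup>2 + (cmod (g x))\<^sup>2)"
  proof (rule AE_I2)
    fix x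
    have "2 * (cmod (f x) * cmod (g x)) \<le> (cmod (f x))\<^sup>2 + (cmod (g x))\<^sup>2"
      using sum_squares_bound[of "cmod (f x)" "cmod (g x)"] by simp
    moreover have "0 \<le> cmod (f x) * cmod (g x)" by simp
    ultimately have "cmod (f x) * cmod (g x) \<le> (cmod (f x))\<^sup>2 + (cmod (g x))\<^sup>2" by linarith
    then show "norm (f x * cnj (g x)) \<le> norm ((cmod (f x))\<^sup>2 + (cmod (g x))\<^sup>2)"
      by (simp add: norm_mult)
  qed
qed

lemma L2_inner_lincomb:
  assumes "f \<in> L2 \<Omega>" "g \<in> L2 \<Omega>" "h \<in> L2 \<Omega>"
  shows "L2_inner \<Omega> (\<lambda>x. s * f x + t * g x) h = s * L2_inner \<Omega> f h + t * L2_inner \<Omega> g h"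
  unfolding L2_inner_def
  using L2_inner_integrable[OF assms(1,3)] L2_inner_integrable[OF assms(2,3)]
  by (simp add: distrib_right mult.assoc)

lemma L2_inner_commute: "L2_inner \<Omega> g f = cnj (L2_inner \<Omega> f g)"
  unfolding L2_inner_def by (subst Bochner_Integration.integral_cnj[symmetric]) (simp add: mult.commute)

lemma L2_inner_lincomb_right:
  assumes "f \<in> L2 \<Omega>" "g \<in> L2 \<Omega>" "h \<in> L2 \<Omega>"
  shows "L2_inner \<Omega> h (\<lambda>x. s * f x + t * g x) = cnj s * L2_inner \<Omega> h f + cnj t * L2_inner \<Omega> h g"
  using L2_inner_lincomb[OF assms, of s t] by (simp add: L2_inner_commute[of \<Omega> h])

lemma L2_inner_diff:
  assumes "f \<in> L2 \<Omega>" "g \<in> L2 \<Omega>" "h \<in> L2 \<Omega>"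
  shows "L2_inner \<Omega> (\<lambda>x. f x - g x) h = L2_inner \<Omega> f h - L2_inner \<Omega> g h"
    and "L2_inner \<Omega> h (\<lambda>x. f x - g x) = L2_inner \<Omega> h f - L2_inner \<Omega> h g"
  using L2_inner_lincomb[OF assms, of 1 "-1"] L2_inner_lincomb_right[OF assms, of 1 "-1"] by simp_all

lemma L2_inner_add:
  assumes "f \<in> L2 \<Omega>" "g \<in> L2 \<Omega>" "h \<in> L2 \<Omega>"
  shows "L2_inner \<Omega> (\<lambda>x. f x + g x) h = L2_inner \<Omega> f h + L2_inner \<Omega> g h"
    and "L2_inner \<Omega> h (\<lambda>x. f x + g x) = L2_inner \<Omega> h f + L2_inner \<Omega> h g"
  using L2_inner_lincomb[OF assms, of 1 1] L2_inner_lincomb_right[OF assms, of 1 1] by simp_all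

lemma L2_inner_zero [simp]: "L2_inner \<Omega> (\<lambda>x. 0) f = 0" "L2_inner \<Omega> f (\<lambda>x. 0) = 0"
  by (simp_all add: L2_inner_def)

lemma L2_inner_cong_ae:
  assumes "ae_eq \<Omega> f f'" "ae_eq \<Omega> g g'"
    and "f \<in> L2 \<Omega>" "g \<in> L2 \<Omega>" "f' \<in> L2 \<Omega>" "g' \<in> L2 \<Omega>"
  shows "L2_inner \<Omega> f g = L2_inner \<Omega> f' g'"
  unfolding L2_inner_def
proof (rule integral_cong_AE)
  show "AE x in lebesgue_on \<Omega>. f x * cnj (g x) = f' x * cnj (g' x)"
    using assms(1,2) unfolding ae_eq_def by eventually_elim simp
qed (use assms(3-6) L2_inner_integrable in \<open>auto intro!: borel_measurable_integrable\<close>)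

lemma L2_norm_nonneg [simp]: "0 \<le> L2_norm \<Omega> f"
  by (simp add: L2_norm_def)

lemma L2_inner_self: "L2_inner \<Omega> f f = of_real ((L2_norm \<Omega> f)\<^sup>2)"
proof -
  have "L2_inner \<Omega> f f = (\<integral>x. of_real ((cmod (f x))\<^sup>2) \<partial>lebesgue_on \<Omega>)"
    unfolding L2_inner_def by (simp only: complex_norm_square)
  also have "\<dots> = of_real (\<integral>x. (cmod (f x))\<^sup>2 \<partial>lebesgue_on \<Omega>)"
    by (rule integral_complex_of_real)
  finally show ?thesis by (simp add: L2_norm_def)
qed

lemma L2_norm_eq_0_D:
  assumes f: "f \<in> L2 \<Omega>" and 0: "L2_norm \<Omega> f = 0"
  shows "AE x in lebesgue_on \<Omega>. f x = 0"
proof -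
  have "(\<integral>x. (cmod (f x))\<^sup>2 \<partial>lebesgue_on \<Omega>) = 0"
    using 0 by (simp add: L2_norm_def)
  then have "AE x in lebesgue_on \<Omega>. (cmod (f x))\<^sup>2 = 0"
    using integral_nonneg_eq_0_iff_AE[OF L2_D(2)[OF f]] by simp
  then show ?thesis by simp
qed

section \<open>Orthogonality and finite-dimensional projection\<close>

lemma L2_Cauchy_Schwarz:
  assumes f: "f \<in> L2 \<Omega>" and g: "g \<in> L2 \<Omega>"
  shows "cmod (L2_inner \<Omega> f g) \<le> L2_norm \<Omega> f * L2_norm \<Omega> g"
proof (cases "L2_norm \<Omega> g = 0")
  case True
  then have "ae_eq \<Omega> g (\<lambda>x. 0)" using L2_norm_eq_0_D[OF g] by (simp add: ae_eq_def)
  then have "L2_inner \<Omega> f g = L2_inner \<Omega> f (\<lambda>x. 0)"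
    by (intro L2_inner_cong_ae) (auto simp: ae_eq_def f g)
  then show ?thesis by simp
next
  case False
  define A B z where "A = (L2_norm \<Omega> f)\<^sup>2" and "B = (L2_norm \<Omega> g)\<^sup>2" and "z = L2_inner \<Omega> f g"
  have B: "B > 0" using False by (simp add: B_def)
  \<comment> \<open>This \<open>w\<close> minimises the norm of \<open>f + w * g\<close>; the
    minimum being nonnegative is the inequality.\<close>
  define w where "w = - z / of_real B"
  let ?u = "\<lambda>x. 1 * f x + w * g x"
  have u: "?u \<in> L2 \<Omega>" using f g by (rule L2_lincomb)
  have "of_real ((L2_norm \<Omega> ?u)\<^sup>2) = L2_inner \<Omega> ?u ?u" by (rule L2_inner_self[symmetric])
  also have "\<dots> = L2_inner \<Omega> f f + cnj w * z + w * (cnj z + cnj w * L2_inner \<Omega> g g)"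
    by (subst L2_inner_lincomb[OF f g u], subst (1 2) L2_inner_lincomb_right[OF f g])
      (auto simp: f g z_def L2_inner_commute[of \<Omega> g f])
  also have "\<dots> = of_real A - z * cnj z / of_real B"
    using B unfolding L2_inner_self A_def[symmetric] B_def[symmetric] w_def by (simp add: field_simps)
  also have "\<dots> = of_real (A - (cmod z)\<^sup>2 / B)"
    by (simp add: complex_norm_square[symmetric])
  finally have "(L2_norm \<Omega> ?u)\<^sup>2 = A - (cmod z)\<^sup>2 / B" using of_real_eq_iff by blast
  then have "(cmod z)\<^sup>2 / B \<le> A" using zero_le_power2[of "L2_norm \<Omega> ?u"] by linarith
  then have "(cmod z)\<^sup>2 \<le> (L2_norm \<Omega> f * L2_norm \<Omega> g)\<^sup>2"
    using B by (simp add: field_simps A_def B_def power_mult_distrib)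
  then show ?thesis unfolding z_def by (rule power2_le_imp_le) simp
qed

text \<open>Pythagoras. It bounds the error of an orthogonal projection by the error of any other
  approximant from the same subspace.\<close>

lemma L2_norm_ortho_le:
  assumes g: "g \<in> L2 \<Omega>" and p: "p \<in> L2 \<Omega>" and q: "q \<in> L2 \<Omega>"
    and ort: "L2_inner \<Omega> (\<lambda>x. g x - p x) (\<lambda>x. p x - q x) = 0"
  shows "L2_norm \<Omega> (\<lambda>x. g x - p x) \<le> L2_norm \<Omega> (\<lambda>x. g x - q x)"
proof -
  let ?r = "\<lambda>x. g x - p x" and ?s = "\<lambda>x. p x - q x" and ?t = "\<lambda>x. g x - q x"
  have L: "?r \<in> L2 \<Omega>" "?s \<in> L2 \<Omega>" "?t \<in> L2 \<Omega>" using g p q by (auto intro: L2_diff)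
  have t: "?t = (\<lambda>x. ?r x + ?s x)" by auto
  have "L2_inner \<Omega> ?t ?t = L2_inner \<Omega> ?r ?t + L2_inner \<Omega> ?s ?t"
    using L2_inner_add(1)[OF L(1,2,3)] by (simp add: t[symmetric])
  also have "L2_inner \<Omega> ?r ?t = L2_inner \<Omega> ?r ?r"
    using L2_inner_add(2)[OF L(1,2,1)] ort by simp
  also have "L2_inner \<Omega> ?s ?t = L2_inner \<Omega> ?s ?s"
    using L2_inner_add(2)[OF L(1,2,2)] ort L2_inner_commute[of \<Omega> ?s ?r] by simp
  finally have "(L2_norm \<Omega> ?t)\<^sup>2 = (L2_norm \<Omega> ?r)\<^sup>2 + (L2_norm \<Omega> ?s)\<^sup>2"
    unfolding L2_inner_self of_real_add[symmetric] of_real_eq_iff .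
  then have "(L2_norm \<Omega> ?r)\<^sup>2 \<le> (L2_norm \<Omega> ?t)\<^sup>2" by simp
  then show ?thesis by (rule power2_le_imp_le) simp
qed

text \<open>Gram-Schmidt: \<open>w\<close> and \<open>g\<close> are reduced to residuals
  \<open>w'\<close> and \<open>g'\<close> orthogonal to \<open>B\<close>; removing from
  \<open>g'\<close> its component along \<open>w'\<close> keeps that orthogonality and adds the one
  to \<open>w\<close>. As \<open>B\<close> may be linearly dependent, \<open>w'\<close> may have
  norm zero.\<close>

lemma L2_projection_finite:
  assumes "finite B" "B \<subseteq> L2 \<Omega>" "g \<in> L2 \<Omega>"
  shows "\<exists>c. \<forall>v\<in>B. L2_inner \<Omega> (\<lambda>x. g x - (\<Sum>b\<in>B. c b * b x)) v = 0"
  using assms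
proof (induction B arbitrary: g rule: finite_induct)
  case empty
  then show ?case by simp
next
  case (insert w B)
  have comb: "(\<lambda>x. \<Sum>b\<in>B. c b * b x) \<in> L2 \<Omega>" for c
    using \<open>finite B\<close> insert.prems(1)
    by (induction B rule: finite_induct) (auto intro!: L2_add L2_scale)
  have w: "w \<in> L2 \<Omega>" and B: "B \<subseteq> L2 \<Omega>" using insert.prems by auto
  obtain c where c: "\<And>v. v \<in> B \<Longrightarrow> L2_inner \<Omega> (\<lambda>x. w x - (\<Sum>b\<in>B. c b * b x)) v = 0"
    using insert.IH[OF B w] by blast
  obtain d where d: "\<And>v. v \<in> B \<Longrightarrow> L2_inner \<Omega> (\<lambda>x. g x - (\<Sum>b\<in>B. d b * b x)) v = 0"
    using insert.IH[OF B insert.prems(2)] by blast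
  define w' where "w' = (\<lambda>x. w x - (\<Sum>b\<in>B. c b * b x))"
  define g' where "g' = (\<lambda>x. g x - (\<Sum>b\<in>B. d b * b x))"
  have w': "w' \<in> L2 \<Omega>" and g': "g' \<in> L2 \<Omega>"
    unfolding w'_def g'_def using w insert.prems(2) comb by (auto intro: L2_diff)
  \<comment> \<open>If \<open>w'\<close> has norm zero, Cauchy-Schwarz makes its inner product with
    \<open>g'\<close> vanish too, so the default 0 is right.\<close>
  define s where "s = (if L2_inner \<Omega> w' w' = 0 then 0 else L2_inner \<Omega> g' w' / L2_inner \<Omega> w' w')"
  have sw: "L2_inner \<Omega> g' w' - s * L2_inner \<Omega> w' w' = 0"
  proof (cases "L2_inner \<Omega> w' w' = 0")
    case True
    then have "L2_norm \<Omega> w' = 0" by (simp add: L2_inner_self)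
    then show ?thesis using L2_Cauchy_Schwarz[OF g' w'] True by simp
  qed (simp add: s_def)
  \<comment> \<open>Chosen so that subtracting the combination from \<open>g\<close> leaves
    \<open>g' - s * w'\<close>.\<close>
  define e where "e = (\<lambda>b. if b = w then s else d b - s * c b)"
  have "(\<Sum>b\<in>insert w B. e b * b x) = s * w x + (\<Sum>b\<in>B. (d b - s * c b) * b x)" for x
  proof -
    have "(\<Sum>b\<in>B. e b * b x) = (\<Sum>b\<in>B. (d b - s * c b) * b x)"
      by (rule sum.cong) (use insert.hyps in \<open>auto simp: e_def\<close>)
    then show ?thesis using insert.hyps by (simp add: e_def)
  qed
  then have "g x - (\<Sum>b\<in>insert w B. e b * b x) = 1 * g' x + (- s) * w' x" for x
    by (simp only: g'_def w'_def) (simp add: algebra_simps sum_subtractf sum_distrib_left sum_negf)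
  then have eq: "(\<lambda>x. g x - (\<Sum>b\<in>insert w B. e b * b x)) = (\<lambda>x. 1 * g' x + (- s) * w' x)" by blast
  have ort: "L2_inner \<Omega> (\<lambda>x. 1 * g' x + (- s) * w' x) v = L2_inner \<Omega> g' v - s * L2_inner \<Omega> w' v"
    if "v \<in> L2 \<Omega>" for v
    using L2_inner_lincomb[OF g' w' that, of 1 "- s"] by simp
  have zB: "L2_inner \<Omega> (\<lambda>x. 1 * g' x + (- s) * w' x) v = 0" if "v \<in> B" for v
    using ort[of v] that B c[OF that] d[OF that] by (auto simp: g'_def w'_def)
  have zc: "L2_inner \<Omega> u (\<lambda>x. \<Sum>b\<in>B. c b * b x) = 0"
    if u: "u \<in> L2 \<Omega>" and "\<And>v. v \<in> B \<Longrightarrow> L2_inner \<Omega> u v = 0" for u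
    using \<open>finite B\<close> B that(2)
  proof (induction B rule: finite_induct)
    case (insert b B)
    have "(\<lambda>x. \<Sum>b\<in>B. c b * b x) \<in> L2 \<Omega>"
      using insert(1,4) by (induction B rule: finite_induct) (auto intro!: L2_add L2_scale)
    then show ?case
      using insert L2_inner_lincomb_right[of b \<Omega> "\<lambda>x. \<Sum>b\<in>B. c b * b x" u "c b" 1] u by simp
  qed simp
  have u: "(\<lambda>x. 1 * g' x + (- s) * w' x) \<in> L2 \<Omega>" using g' w' by (rule L2_lincomb)
  \<comment> \<open>\<open>w\<close> is \<open>w'\<close> plus a combination of \<open>B\<close>,
    and the new residual is orthogonal to both.\<close>
  have "w = (\<lambda>x. w' x + (\<Sum>b\<in>B. c b * b x))" by (auto simp: w'_def)
  then have "L2_inner \<Omega> (\<lambda>x. 1 * g' x + (- s) * w' x) w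
      = L2_inner \<Omega> (\<lambda>x. 1 * g' x + (- s) * w' x) w'
        + L2_inner \<Omega> (\<lambda>x. 1 * g' x + (- s) * w' x) (\<lambda>x. \<Sum>b\<in>B. c b * b x)"
    using L2_inner_add(2)[OF w' comb u] by simp
  also have "\<dots> = 0" using ort[OF w'] sw zc[OF u zB] by simp
  finally have "\<forall>v\<in>insert w B. L2_inner \<Omega> (\<lambda>x. g x - (\<Sum>b\<in>insert w B. e b * b x)) v = 0"
    using zB unfolding eq by blast
  then show ?case by blast
qed

text \<open>Otherwise some \<open>u\<close> in \<open>W\<close> is closer to \<open>f\<close> than
  the norm of \<open>f\<close>, and pairing \<open>f - u\<close> with \<open>f\<close> contradicts
  Cauchy-Schwarz.\<close>

lemma L2_orthogonal_dense_eq_0: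
  assumes dense: "\<And>f e. f \<in> L2 \<Omega> \<Longrightarrow> e > 0 \<Longrightarrow> \<exists>u\<in>W. L2_norm \<Omega> (\<lambda>x. f x - u x) < e"
    and W: "W \<subseteq> L2 \<Omega>" and f: "f \<in> L2 \<Omega>"
    and ort: "\<And>u. u \<in> W \<Longrightarrow> L2_inner \<Omega> u f = 0"
  shows "L2_norm \<Omega> f = 0"
proof (rule ccontr)
  assume "L2_norm \<Omega> f \<noteq> 0"
  then have pos: "L2_norm \<Omega> f > 0" by (simp add: order_less_le)
  obtain u where u: "u \<in> W" "L2_norm \<Omega> (\<lambda>x. f x - u x) < L2_norm \<Omega> f"
    using dense[OF f pos] by blast
  then have uL: "u \<in> L2 \<Omega>" using W by blast
  have "L2_inner \<Omega> f f = L2_inner \<Omega> (\<lambda>x. f x - u x) f"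
    using L2_inner_diff(1)[OF f uL f] ort[OF u(1)] by simp
  then have "(L2_norm \<Omega> f)\<^sup>2 = cmod (L2_inner \<Omega> (\<lambda>x. f x - u x) f)"
    by (metis L2_inner_self norm_of_real abs_of_nonneg zero_le_power2)
  also have "\<dots> \<le> L2_norm \<Omega> (\<lambda>x. f x - u x) * L2_norm \<Omega> f"
    by (intro L2_Cauchy_Schwarz L2_diff f uL)
  also have "\<dots> < L2_norm \<Omega> f * L2_norm \<Omega> f"
    using u(2) pos by (intro mult_strict_right_mono)
  finally show False by (simp add: power2_eq_square)
qed

section \<open>Adjoint graphs and self-adjointness\<close>

lemma adjoint_graph_D:
  assumes "(g, h) \<in> adjoint_graph \<Omega> T"
  shows "g \<in> L2 \<Omega>" "h \<in> L2 \<Omega>" "\<And>u v. (u, v) \<in> T \<Longrightarrow> L2_inner \<Omega> v g = L2_inner \<Omega> u h"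
  using assms by (auto simp: adjoint_graph_def)

text \<open>Stated for a bare set of pairs because the generator used later consists of actual
  polynomials and is not saturated under equality almost everywhere; its adjoint is. Density makes
  the adjoint single-valued.\<close>

lemma L2_operator_adjoint_graph:
  assumes T: "T \<subseteq> L2 \<Omega> \<times> L2 \<Omega>"
    and dense: "densely_defined \<Omega> T"
  shows "L2_operator \<Omega> (adjoint_graph \<Omega> T)"
proof -
  have D: "u \<in> L2 \<Omega>" "v \<in> L2 \<Omega>" if "(u, v) \<in> T" for u v using that T by auto
  have "(f', g') \<in> adjoint_graph \<Omega> T"
    if fg: "(f, g) \<in> adjoint_graph \<Omega> T" and "f' \<in> L2 \<Omega>" "g' \<in> L2 \<Omega>" "ae_eq \<Omega> f f'" "ae_eq \<Omega> g g'"
    for f g f' g'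
  proof -
    have "L2_inner \<Omega> v f' = L2_inner \<Omega> u g'" if uv: "(u, v) \<in> T" for u v
    proof -
      have "L2_inner \<Omega> v f' = L2_inner \<Omega> v f" "L2_inner \<Omega> u g' = L2_inner \<Omega> u g"
        by (rule L2_inner_cong_ae[symmetric];
            use that D[OF uv] adjoint_graph_D(1,2)[OF fg] \<open>f' \<in> _\<close> \<open>g' \<in> _\<close> \<open>ae_eq \<Omega> f f'\<close> \<open>ae_eq \<Omega> g g'\<close>
            in \<open>simp add: ae_eq_def\<close>)+
      then show ?thesis using adjoint_graph_D(3)[OF fg uv] by simp
    qed
    then show ?thesis using that by (auto simp: adjoint_graph_def)
  qed
  moreover have "ae_eq \<Omega> g g'"
    if fg: "(f, g) \<in> adjoint_graph \<Omega> T" and fg': "(f, g') \<in> adjoint_graph \<Omega> T" for f g g'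
  proof -
    note L = adjoint_graph_D(2)[OF fg] adjoint_graph_D(2)[OF fg']
    have "L2_norm \<Omega> (\<lambda>x. g x - g' x) = 0"
    proof (rule L2_orthogonal_dense_eq_0[of \<Omega> "Domain T"])
      show "\<exists>u\<in>Domain T. L2_norm \<Omega> (\<lambda>x. f x - u x) < e" if "f \<in> L2 \<Omega>" "e > 0" for f e
        using dense that unfolding densely_defined_def by blast
      show "Domain T \<subseteq> L2 \<Omega>" using D by auto
      show "L2_inner \<Omega> u (\<lambda>x. g x - g' x) = 0" if "u \<in> Domain T" for u
        using that L2_inner_diff(2)[OF L] adjoint_graph_D(3)[OF fg] adjoint_graph_D(3)[OF fg'] D
        by (metis DomainE cancel_comm_monoid_add_class.diff_cancel)
    qed (intro L2_diff L)
    from L2_norm_eq_0_D[OF L2_diff[OF L] this] show ?thesis by (simp add: ae_eq_def)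
  qed
  moreover have "(\<lambda>x. s * f x + t * u x, \<lambda>x. s * g x + t * v x) \<in> adjoint_graph \<Omega> T"
    if fg: "(f, g) \<in> adjoint_graph \<Omega> T" and uv: "(u, v) \<in> adjoint_graph \<Omega> T" for f g u v s t
  proof -
    note L = adjoint_graph_D[OF fg] adjoint_graph_D[OF uv]
    show ?thesis
      unfolding adjoint_graph_def
      using L D by (auto intro!: L2_lincomb simp: L2_inner_lincomb_right)
  qed
  moreover have "(\<lambda>x. 0, \<lambda>x. 0) \<in> adjoint_graph \<Omega> T" by (auto simp: adjoint_graph_def)
  moreover have "adjoint_graph \<Omega> T \<subseteq> L2 \<Omega> \<times> L2 \<Omega>" by (auto simp: adjoint_graph_def)
  ultimately show ?thesis
    unfolding L2_operator_def by (intro conjI) (blast | fast)+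
qed

definition symmetric_graph :: "'a::euclidean_space set \<Rightarrow> 'a graph \<Rightarrow> bool" where
  "symmetric_graph \<Omega> T \<longleftrightarrow>
     (\<forall>(f, g)\<in>T. \<forall>(u, v)\<in>T. L2_inner \<Omega> g u = L2_inner \<Omega> f v)"

lemma symmetric_graphD:
  "symmetric_graph \<Omega> T \<Longrightarrow> (f, g) \<in> T \<Longrightarrow> (u, v) \<in> T \<Longrightarrow> L2_inner \<Omega> g u = L2_inner \<Omega> f v"
  unfolding symmetric_graph_def by blast

text \<open>Taking adjoints reverses inclusions: \<open>T\<close> lies in its adjoint by symmetry,
  so the second adjoint lies in the first. The converse inclusion is the symmetry of the
  adjoint.\<close>

lemma self_adjoint_adjoint_graph:
  assumes T: "T \<subseteq> L2 \<Omega> \<times> L2 \<Omega>" and dense: "densely_defined \<Omega> T"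
    and sym: "symmetric_graph \<Omega> T" and sym': "symmetric_graph \<Omega> (adjoint_graph \<Omega> T)"
  shows "self_adjoint \<Omega> (adjoint_graph \<Omega> T)"
proof -
  have sub: "T \<subseteq> adjoint_graph \<Omega> T"
    using T sym unfolding adjoint_graph_def symmetric_graph_def by fast
  have "adjoint_graph \<Omega> (adjoint_graph \<Omega> T) \<subseteq> adjoint_graph \<Omega> T"
    using sub unfolding adjoint_graph_def by fast
  moreover have "adjoint_graph \<Omega> T \<subseteq> adjoint_graph \<Omega> (adjoint_graph \<Omega> T)"
    using sym' adjoint_graph_D(1,2)[of _ _ \<Omega> T] symmetric_graphD[OF sym']
    by (subst (2) adjoint_graph_def) auto
  moreover have "densely_defined \<Omega> (adjoint_graph \<Omega> T)"
    using dense sub unfolding densely_defined_def by (meson Domain_mono in_mono)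
  ultimately show ?thesis
    using L2_operator_adjoint_graph[OF T dense] by (auto simp: self_adjoint_def)
qed

text \<open>For a pair (g, h) of the adjoint, invariance of \<open>V n\<close> makes the projection
  of \<open>h\<close> equal to \<open>L\<close> applied to the projection of \<open>g\<close>.
  Symmetry therefore holds exactly between the projections, and density removes the projection
  errors as \<open>n\<close> grows.\<close>

lemma adjoint_graph_of_invariant_finite_dimensional:
  fixes V :: "nat \<Rightarrow> ('a::euclidean_space \<Rightarrow> complex) set"
  defines "W \<equiv> (\<Union>n. V n)"
  assumes V: "\<And>n. V n \<subseteq> L2 \<Omega>"
    and mono: "\<And>n. V n \<subseteq> V (Suc n)"
    and fin: "\<And>n. \<exists>B. finite B \<and> B \<subseteq> V n \<and> (\<forall>v\<in>V n. \<exists>c. v = (\<lambda>x. \<Sum>b\<in>B. c b * b x))"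
    and zero: "\<And>n. (\<lambda>x. 0) \<in> V n"
    and comb: "\<And>n f g s t. f \<in> V n \<Longrightarrow> g \<in> V n \<Longrightarrow> (\<lambda>x. s * f x + t * g x) \<in> V n"
    and L_inv: "\<And>n v. v \<in> V n \<Longrightarrow> L v \<in> V n"
    and sym: "\<And>u v. u \<in> W \<Longrightarrow> v \<in> W \<Longrightarrow> L2_inner \<Omega> (L u) v = L2_inner \<Omega> u (L v)"
    and dense: "\<And>f e. f \<in> L2 \<Omega> \<Longrightarrow> e > 0 \<Longrightarrow> \<exists>u\<in>W. L2_norm \<Omega> (\<lambda>x. f x - u x) < e"
  shows "symmetric_graph \<Omega> (adjoint_graph \<Omega> {(u, L u) | u. u \<in> W})"
proof -
  have WL: "u \<in> L2 \<Omega>" if "u \<in> W" for u using that V by (auto simp: W_def)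
  have proj: "\<exists>p\<in>V n. \<forall>v\<in>V n. L2_inner \<Omega> (\<lambda>x. g x - p x) v = 0" if g: "g \<in> L2 \<Omega>" for n g
  proof -
    obtain B where B: "finite B" "B \<subseteq> V n" and gen: "\<And>v. v \<in> V n \<Longrightarrow> \<exists>c. v = (\<lambda>x. \<Sum>b\<in>B. c b * b x)"
      using fin[of n] by blast
    have BL: "B \<subseteq> L2 \<Omega>" using B(2) V by blast
    obtain c where c: "\<And>b. b \<in> B \<Longrightarrow> L2_inner \<Omega> (\<lambda>x. g x - (\<Sum>b\<in>B. c b * b x)) b = 0"
      using L2_projection_finite[OF B(1) BL g] by blast
    have lc: "(\<lambda>x. \<Sum>b\<in>A. d b * b x) \<in> V n" if "A \<subseteq> B" for A d
      using finite_subset[OF that B(1)] that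
    proof (induction A rule: finite_induct)
      case (insert b A)
      then show ?case
        using comb[of b n "\<lambda>x. \<Sum>b\<in>A. d b * b x" "d b" 1] B(2) by auto
    qed (simp add: zero)
    define r where "r = (\<lambda>x. g x - (\<Sum>b\<in>B. c b * b x))"
    have rL: "r \<in> L2 \<Omega>" unfolding r_def using g lc[OF order_refl, of c] V[of n] by (intro L2_diff) auto
    have "L2_inner \<Omega> r (\<lambda>x. \<Sum>b\<in>A. d b * b x) = 0" if "A \<subseteq> B" for A d
      using finite_subset[OF that B(1)] that
    proof (induction A rule: finite_induct)
      case (insert b A)
      have "(\<lambda>x. \<Sum>b\<in>A. d b * b x) \<in> L2 \<Omega>" "b \<in> L2 \<Omega>"
        using lc[of A d] insert.prems V BL by auto
      then show ?case
        using insert L2_inner_lincomb_right[of b \<Omega> "\<lambda>x. \<Sum>b\<in>A. d b * b x" r "d b" 1] rL c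
        by (simp add: r_def)
    qed simp
    then have "L2_inner \<Omega> r v = 0" if "v \<in> V n" for v
      using gen[OF that] by blast
    then show ?thesis
      using lc[OF order_refl, of c] unfolding r_def by (intro bexI[of _ "\<lambda>x. \<Sum>b\<in>B. c b * b x"] ballI)
  qed
  have ubound: "cmod (L2_inner \<Omega> h g' - L2_inner \<Omega> g h') \<le> e * (L2_norm \<Omega> g' + L2_norm \<Omega> h')"
    if gh: "(g, h) \<in> adjoint_graph \<Omega> {(u, L u) | u. u \<in> W}"
      and gh': "(g', h') \<in> adjoint_graph \<Omega> {(u, L u) | u. u \<in> W}" and e: "e > 0" for g h g' h' e
  proof -
    have L: "g \<in> L2 \<Omega>" "h \<in> L2 \<Omega>" "g' \<in> L2 \<Omega>" "h' \<in> L2 \<Omega>"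
      using adjoint_graph_D[OF gh] adjoint_graph_D[OF gh'] by auto
    have adj: "L2_inner \<Omega> (L u) g = L2_inner \<Omega> u h" "L2_inner \<Omega> (L u) g' = L2_inner \<Omega> u h'"
      if "u \<in> W" for u
      using adjoint_graph_D(3)[OF gh] adjoint_graph_D(3)[OF gh'] that by auto
    obtain k q where q: "q \<in> V k" "L2_norm \<Omega> (\<lambda>x. g x - q x) < e"
      using dense[OF L(1) e] by (auto simp: W_def)
    obtain l r where r: "r \<in> V l" "L2_norm \<Omega> (\<lambda>x. h x - r x) < e"
      using dense[OF L(2) e] by (auto simp: W_def)
    \<comment> \<open>A single space has to approximate both \<open>g\<close> and
      \<open>h\<close>.\<close>
    define n where "n = max k l"
    have "V k \<subseteq> V n" "V l \<subseteq> V n"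
      using lift_Suc_mono_le[of V, OF mono] by (auto simp: n_def)
    then have qr: "q \<in> V n" "r \<in> V n" using q r by auto
    have ex: "\<exists>p\<in>V n. \<forall>v\<in>V n. L2_inner \<Omega> f v = L2_inner \<Omega> p v \<and> L2_inner \<Omega> v f = L2_inner \<Omega> v p"
      if f: "f \<in> L2 \<Omega>" for f
    proof -
      obtain p where p: "p \<in> V n" "\<And>v. v \<in> V n \<Longrightarrow> L2_inner \<Omega> (\<lambda>x. f x - p x) v = 0"
        using proj[OF f, of n] by blast
      have "L2_inner \<Omega> f v = L2_inner \<Omega> p v" if "v \<in> V n" for v
        using p(2)[OF that] L2_inner_diff(1)[of f \<Omega> p v] V p(1) f that by auto
      then show ?thesis using p(1) by (auto simp: L2_inner_commute[of \<Omega> _ f] L2_inner_commute[of \<Omega> _ p])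
    qed
    obtain pg where pg: "pg \<in> V n"
        "\<And>v. v \<in> V n \<Longrightarrow> L2_inner \<Omega> g v = L2_inner \<Omega> pg v" "\<And>v. v \<in> V n \<Longrightarrow> L2_inner \<Omega> v g = L2_inner \<Omega> v pg"
      using ex[OF L(1)] by blast
    obtain ph where ph: "ph \<in> V n"
        "\<And>v. v \<in> V n \<Longrightarrow> L2_inner \<Omega> h v = L2_inner \<Omega> ph v" "\<And>v. v \<in> V n \<Longrightarrow> L2_inner \<Omega> v h = L2_inner \<Omega> v ph"
      using ex[OF L(2)] by blast
    obtain pg' where pg': "pg' \<in> V n"
        "\<And>v. v \<in> V n \<Longrightarrow> L2_inner \<Omega> g' v = L2_inner \<Omega> pg' v" "\<And>v. v \<in> V n \<Longrightarrow> L2_inner \<Omega> v g' = L2_inner \<Omega> v pg'"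
      using ex[OF L(3)] by blast
    have VW: "v \<in> W" if "v \<in> V n" for v using that by (auto simp: W_def)
    have VL: "v \<in> L2 \<Omega>" if "v \<in> V n" for v using that V by auto
    have close: "L2_norm \<Omega> (\<lambda>x. f x - p x) \<le> e"
      if f: "f \<in> L2 \<Omega>" and p: "p \<in> V n" "\<And>v. v \<in> V n \<Longrightarrow> L2_inner \<Omega> f v = L2_inner \<Omega> p v"
        and s: "s \<in> V n" "L2_norm \<Omega> (\<lambda>x. f x - s x) < e" for f p s
    proof -
      have "(\<lambda>x. p x - s x) \<in> V n" using comb[OF p(1) s(1), of 1 "-1"] by simp
      then have "L2_inner \<Omega> (\<lambda>x. f x - p x) (\<lambda>x. p x - s x) = 0"
        using L2_inner_diff(1)[OF f VL[OF p(1)] VL] p(2) by simp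
      from L2_norm_ortho_le[OF f VL[OF p(1)] VL[OF s(1)] this] s(2) show ?thesis by simp
    qed
    \<comment> \<open>Each replacement of a function by its projection is exact, because the other
      factor lies in \<open>V n\<close>; for \<open>L pg'\<close> and \<open>L pg\<close> this is
      the invariance under \<open>L\<close>. Errors arise only afterwards, when \<open>ph\<close>
      and \<open>pg\<close> are exchanged for \<open>h\<close> and \<open>g\<close>.\<close>
    have "L2_inner \<Omega> ph g' = L2_inner \<Omega> ph pg'" using pg'(3) ph(1) by simp
    also have "\<dots> = L2_inner \<Omega> h pg'" using ph(2) pg'(1) by simp
    also have "\<dots> = L2_inner \<Omega> g (L pg')"
      using adj(1)[OF VW[OF pg'(1)]] by (simp add: L2_inner_commute[of \<Omega> h] L2_inner_commute[of \<Omega> g])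
    also have "\<dots> = L2_inner \<Omega> pg (L pg')" using pg(2)[OF L_inv[OF pg'(1)]] .
    also have "\<dots> = L2_inner \<Omega> (L pg) pg'" using sym[OF VW[OF pg(1)] VW[OF pg'(1)]] by simp
    also have "\<dots> = L2_inner \<Omega> (L pg) g'" using pg'(3)[OF L_inv[OF pg(1)]] by simp
    also have "\<dots> = L2_inner \<Omega> pg h'" using adj(2)[OF VW[OF pg(1)]] .
    finally have eq: "L2_inner \<Omega> ph g' = L2_inner \<Omega> pg h'" .
    have "L2_inner \<Omega> h g' - L2_inner \<Omega> g h'
        = L2_inner \<Omega> (\<lambda>x. h x - ph x) g' - L2_inner \<Omega> (\<lambda>x. g x - pg x) h'"
      using L2_inner_diff(1)[OF L(2) VL[OF ph(1)] L(3)] L2_inner_diff(1)[OF L(1) VL[OF pg(1)] L(4)] eq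
      by simp
    also have "cmod \<dots> \<le> cmod (L2_inner \<Omega> (\<lambda>x. h x - ph x) g') + cmod (L2_inner \<Omega> (\<lambda>x. g x - pg x) h')"
      by (rule norm_triangle_ineq4)
    also have "\<dots> \<le> L2_norm \<Omega> (\<lambda>x. h x - ph x) * L2_norm \<Omega> g' + L2_norm \<Omega> (\<lambda>x. g x - pg x) * L2_norm \<Omega> h'"
      by (intro add_mono L2_Cauchy_Schwarz L2_diff L VL ph pg)
    also have "\<dots> \<le> e * L2_norm \<Omega> g' + e * L2_norm \<Omega> h'"
      using close[OF L(1) pg(1,2) qr(1) q(2)] close[OF L(2) ph(1,2) qr(2) r(2)]
      by (intro add_mono mult_right_mono) auto
    finally show ?thesis by (simp add: distrib_left)
  qed
  have "L2_inner \<Omega> h g' = L2_inner \<Omega> g h'"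
    if gh: "(g, h) \<in> adjoint_graph \<Omega> {(u, L u) | u. u \<in> W}"
      and gh': "(g', h') \<in> adjoint_graph \<Omega> {(u, L u) | u. u \<in> W}" for g h g' h'
  proof -
    \<comment> \<open>The summand 1 keeps the divisor positive when both norms vanish.\<close>
    define c where "c = L2_norm \<Omega> g' + L2_norm \<Omega> h' + 1"
    have c: "c > 0" unfolding c_def using L2_norm_nonneg[of \<Omega> g'] L2_norm_nonneg[of \<Omega> h'] by linarith
    have "cmod (L2_inner \<Omega> h g' - L2_inner \<Omega> g h') \<le> 0 + e" if "e > 0" for e
    proof -
      have "cmod (L2_inner \<Omega> h g' - L2_inner \<Omega> g h') \<le> e / c * (L2_norm \<Omega> g' + L2_norm \<Omega> h')"
        using ubound[OF gh gh', of "e / c"] that c by simp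
      also have "\<dots> \<le> e / c * c" using that c by (intro mult_left_mono) (auto simp: c_def)
      finally show ?thesis using c by simp
    qed
    then have "cmod (L2_inner \<Omega> h g' - L2_inner \<Omega> g h') \<le> 0" by (rule field_le_epsilon)
    then show ?thesis by simp
  qed
  then show ?thesis unfolding symmetric_graph_def by blast
qed

text \<open>Replacing \<open>h\<close> by \<open>h - c * g\<close> carries a pair from the adjoint
  of \<open>L + c\<close> to the adjoint of \<open>L\<close>, and multiplication by a real function
  is symmetric. The term is split off because multiplication by a quadratic polynomial raises
  degrees, which would destroy the invariance of the polynomial spaces.\<close>

lemma adjoint_graph_bounded_perturbation:
  fixes c :: "'a::euclidean_space \<Rightarrow> real"
  assumes W: "W \<subseteq> L2 \<Omega>" and L: "\<And>u. u \<in> W \<Longrightarrow> L u \<in> L2 \<Omega>"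
    and c: "\<And>f. f \<in> L2 \<Omega> \<Longrightarrow> (\<lambda>x. of_real (c x) * f x) \<in> L2 \<Omega>"
    and sym: "symmetric_graph \<Omega> (adjoint_graph \<Omega> {(u, L u) | u. u \<in> W})"
  shows "symmetric_graph \<Omega> (adjoint_graph \<Omega> {(u, \<lambda>x. L u x + of_real (c x) * u x) | u. u \<in> W})"
proof -
  let ?T = "adjoint_graph \<Omega> {(u, \<lambda>x. L u x + of_real (c x) * u x) | u. u \<in> W}"
  have c_sym: "L2_inner \<Omega> (\<lambda>x. of_real (c x) * f x) g = L2_inner \<Omega> f (\<lambda>x. of_real (c x) * g x)" for f g
    unfolding L2_inner_def by (simp add: ac_simps)
  have shift: "(g, \<lambda>x. h x - of_real (c x) * g x) \<in> adjoint_graph \<Omega> {(u, L u) | u. u \<in> W}"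
    if gh: "(g, h) \<in> ?T" for g h
  proof -
    note gL = adjoint_graph_D(1)[OF gh] and hL = adjoint_graph_D(2)[OF gh]
    have "L2_inner \<Omega> (L u) g = L2_inner \<Omega> u (\<lambda>x. h x - of_real (c x) * g x)" if u: "u \<in> W" for u
    proof -
      have uL: "u \<in> L2 \<Omega>" using W u by blast
      have "L2_inner \<Omega> (\<lambda>x. L u x + of_real (c x) * u x) g = L2_inner \<Omega> u h"
        using adjoint_graph_D(3)[OF gh] u by blast
      then show ?thesis
        using L2_inner_add(1)[OF L[OF u] c[OF uL] gL] L2_inner_diff(2)[OF hL c[OF gL] uL] c_sym[of u g]
        by (simp add: algebra_simps)
    qed
    then show ?thesis using gL hL c by (auto simp: adjoint_graph_def intro!: L2_diff)
  qed
  have "L2_inner \<Omega> h g' = L2_inner \<Omega> g h'" if gh: "(g, h) \<in> ?T" and gh': "(g', h') \<in> ?T" for g h g' h'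
  proof -
    note M = adjoint_graph_D(1,2)[OF gh] adjoint_graph_D(1,2)[OF gh']
    show ?thesis
      using symmetric_graphD[OF sym shift[OF gh] shift[OF gh']]
        L2_inner_diff(1)[OF M(2) c[OF M(1)] M(3)] L2_inner_diff(2)[OF M(4) c[OF M(3)] M(1)] c_sym[of g g']
      by simp
  qed
  then show ?thesis unfolding symmetric_graph_def by blast
qed

section \<open>Density of continuous functions\<close>

lemma L2_norm_triangle:
  assumes f: "f \<in> L2 \<Omega>" and g: "g \<in> L2 \<Omega>"
  shows "L2_norm \<Omega> (\<lambda>x. f x + g x) \<le> L2_norm \<Omega> f + L2_norm \<Omega> g"
proof -
  have fg: "(\<lambda>x. f x + g x) \<in> L2 \<Omega>" using f g by (rule L2_add)
  have "complex_of_real ((L2_norm \<Omega> (\<lambda>x. f x + g x))\<^sup>2)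
      = (L2_inner \<Omega> f f + L2_inner \<Omega> f g) + (L2_inner \<Omega> g f + L2_inner \<Omega> g g)"
    unfolding L2_inner_self[symmetric]
    by (simp add: L2_inner_add(1)[OF f g fg] L2_inner_add(2)[OF f g f] L2_inner_add(2)[OF f g g])
  then have "(L2_norm \<Omega> (\<lambda>x. f x + g x))\<^sup>2
      = Re ((L2_inner \<Omega> f f + L2_inner \<Omega> f g) + (L2_inner \<Omega> g f + L2_inner \<Omega> g g))"
    by (metis Re_complex_of_real)
  also have "\<dots> = (L2_norm \<Omega> f)\<^sup>2 + (L2_norm \<Omega> g)\<^sup>2 + 2 * Re (L2_inner \<Omega> f g)"
    by (simp add: L2_inner_self L2_inner_commute[of \<Omega> g f])
  also have "Re (L2_inner \<Omega> f g) \<le> L2_norm \<Omega> f * L2_norm \<Omega> g"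
    using L2_Cauchy_Schwarz[OF f g] complex_Re_le_cmod order_trans by blast
  finally have "(L2_norm \<Omega> (\<lambda>x. f x + g x))\<^sup>2 \<le> (L2_norm \<Omega> f + L2_norm \<Omega> g)\<^sup>2"
    by (simp add: power2_sum)
  then show ?thesis by (rule power2_le_imp_le) simp
qed

lemma finite_measure_lebesgue_on: "S \<in> lmeasurable \<Longrightarrow> finite_measure (lebesgue_on S)"
  by (rule finite_measureI) (auto simp: emeasure_restrict_space fmeasurable_def)

lemma integrable_bounded_lmeasurable:
  fixes f :: "'a::euclidean_space \<Rightarrow> 'b::{banach, second_countable_topology}"
  assumes S: "S \<in> lmeasurable" and f: "f \<in> borel_measurable (lebesgue_on S)"
    and bd: "\<And>x. x \<in> S \<Longrightarrow> norm (f x) \<le> B"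
  shows "integrable (lebesgue_on S) f"
proof -
  interpret finite_measure "lebesgue_on S" using S by (rule finite_measure_lebesgue_on)
  show ?thesis using bd by (intro integrable_const_bound[where B = B] f AE_I2) simp
qed

lemma L2_bounded:
  assumes S: "S \<in> lmeasurable" and f: "f \<in> borel_measurable (lebesgue_on S)"
    and bd: "\<And>x. x \<in> S \<Longrightarrow> cmod (f x) \<le> B"
  shows "f \<in> L2 S"
proof -
  note [measurable] = f
  have "integrable (lebesgue_on S) (\<lambda>x. (cmod (f x))\<^sup>2)"
  proof (rule integrable_bounded_lmeasurable[OF S, where B = "B\<^sup>2"])
    show "norm ((cmod (f x))\<^sup>2) \<le> B\<^sup>2" if "x \<in> S" for x
      using power_mono[OF bd[OF that], of 2] by simp
  qed measurable
  then show ?thesis by (simp add: L2_def)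
qed

lemma L2_norm_bounded:
  assumes S: "S \<in> lmeasurable" and f: "f \<in> borel_measurable (lebesgue_on S)"
    and bd: "\<And>x. x \<in> S \<Longrightarrow> cmod (f x) \<le> B" and B: "B \<ge> 0"
  shows "L2_norm S f \<le> B * sqrt (measure lebesgue S)"
proof -
  interpret finite_measure "lebesgue_on S" using S by (rule finite_measure_lebesgue_on)
  have "(\<integral>x. (cmod (f x))\<^sup>2 \<partial>lebesgue_on S) \<le> (\<integral>x. B\<^sup>2 \<partial>lebesgue_on S)"
    using L2_D(2)[OF L2_bounded[OF S f bd]] bd
    by (intro integral_mono) (auto intro: power_mono)
  also have "\<dots> = B\<^sup>2 * measure lebesgue S"
    using S by (simp add: measure_restrict_space fmeasurable_def)
  finally have "L2_norm S f \<le> sqrt (B\<^sup>2 * measure lebesgue S)"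
    by (simp add: L2_norm_def)
  then show ?thesis using B by (simp add: real_sqrt_mult)
qed

lemma borel_measurable_continuous_lebesgue_on:
  fixes f :: "'a::euclidean_space \<Rightarrow> 'b::euclidean_space"
  assumes "continuous_on S f" "S \<in> sets lebesgue"
  shows "f \<in> borel_measurable (lebesgue_on S)"
  using assms by (rule continuous_imp_measurable_on_sets_lebesgue)

lemma L2_continuous:
  assumes S: "compact S" and f: "continuous_on S f"
  shows "f \<in> L2 S"
proof -
  obtain B where "\<And>x. x \<in> S \<Longrightarrow> cmod (f x) \<le> B"
    using compact_imp_bounded[OF compact_continuous_image[OF f S]] by (auto simp: bounded_iff)
  then show ?thesis
    using f S lmeasurable_compact[OF S]
    by (intro L2_bounded borel_measurable_continuous_lebesgue_on) (auto simp: fmeasurable_def)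
qed

lemma L2_dense_bounded:
  assumes f: "f \<in> L2 \<Omega>" and e: "e > 0"
  shows "\<exists>k::real. k > 0 \<and> L2_norm \<Omega> (\<lambda>x. f x - (if cmod (f x) \<le> k then f x else 0)) < e"
proof -
  note [measurable] = L2_D(1)[OF f]
  define r where "r = (\<lambda>(k::nat) x. f x - (if cmod (f x) \<le> real k then f x else 0))"
  have "(\<lambda>k. \<integral>x. (cmod (r k x))\<^sup>2 \<partial>lebesgue_on \<Omega>) \<longlonglongrightarrow> (\<integral>x. 0 \<partial>lebesgue_on \<Omega>)"
  proof (rule integral_dominated_convergence[where w = "\<lambda>x. (cmod (f x))\<^sup>2"])
    show "AE x in lebesgue_on \<Omega>. (\<lambda>k. (cmod (r k x))\<^sup>2) \<longlonglongrightarrow> 0"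
    proof (rule AE_I2)
      fix x
      have "\<forall>\<^sub>F k in sequentially. (cmod (r k x))\<^sup>2 = 0"
        using eventually_ge_at_top[of "nat \<lceil>cmod (f x)\<rceil>"]
        by eventually_elim (auto simp: r_def)
      then show "(\<lambda>k. (cmod (r k x))\<^sup>2) \<longlonglongrightarrow> 0" by (rule tendsto_eventually)
    qed
    show "AE x in lebesgue_on \<Omega>. norm ((cmod (r k x))\<^sup>2) \<le> (cmod (f x))\<^sup>2" for k
      by (auto simp: r_def)
  qed (use L2_D(2)[OF f] in \<open>auto simp: r_def\<close>)
  then have "(\<lambda>k. L2_norm \<Omega> (r k)) \<longlonglongrightarrow> 0"
    unfolding L2_norm_def using tendsto_real_sqrt by fastforce
  from order_tendstoD(2)[OF this e] have "\<forall>\<^sub>F k in sequentially. L2_norm \<Omega> (r k) < e \<and> k > 0"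
    by (intro eventually_conj eventually_gt_at_top)
  then obtain k where "L2_norm \<Omega> (r k) < e" "k > 0" by (auto simp: eventually_sequentially)
  then show ?thesis unfolding r_def by (intro exI[of _ "real k"]) auto
qed

lemma L2_dense_continuous_of_bounded:
  assumes S: "S \<in> lmeasurable" and f: "f \<in> borel_measurable (lebesgue_on S)"
    and bd: "\<And>x. x \<in> S \<Longrightarrow> cmod (f x) \<le> k" and k: "k > 0" and e: "e > 0"
  shows "\<exists>g. continuous_on UNIV g \<and> L2_norm S (\<lambda>x. f x - g x) < e"
proof -
  have Sl: "S \<in> sets lebesgue" using S by auto
  have "f measurable_on S" using f by (simp add: measurable_on_iff_borel_measurable[OF Sl])
  then obtain N g where N: "negligible N" and g: "\<And>n. continuous_on UNIV (g n)"
      and lim: "\<And>x. x \<notin> N \<Longrightarrow> (\<lambda>n. g n x) \<longlonglongrightarrow> (if x \<in> S then f x else 0)"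
    unfolding measurable_on_def by blast
  \<comment> \<open>Radial retraction onto the closed disc of radius \<open>k\<close>. It is
    continuous and fixes the values of \<open>f\<close>, so clamping the approximants preserves
    their limit and makes them uniformly bounded, hence dominated on a set of finite
    measure.\<close>
  define cl :: "complex \<Rightarrow> complex" where "cl = (\<lambda>z. z / of_real (max 1 (cmod z / k)))"
  have "max 1 (cmod z / k) \<noteq> 0" for z by (smt (verit))
  then have cl_cont: "continuous_on UNIV cl"
    unfolding cl_def by (intro continuous_intros ballI) (simp_all only: of_real_eq_0_iff not_False_eq_True, use k in auto)
  have cl_id: "cl z = z" if "cmod z \<le> k" for z
    using that k by (simp add: cl_def max_def field_simps)
  have cl_bd: "cmod (cl z) \<le> k" for z
    using k by (auto simp: cl_def norm_divide max_def field_simps)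
  define h where "h = (\<lambda>n x. cl (g n x))"
  have h: "continuous_on UNIV (h n)" for n
    unfolding h_def using continuous_on_compose2[OF cl_cont g] by simp
  have [measurable]: "h n \<in> borel_measurable (lebesgue_on S)" for n
    using h Sl continuous_on_subset by (blast intro: borel_measurable_continuous_lebesgue_on)
  note [measurable] = f
  interpret finite_measure "lebesgue_on S" using S by (rule finite_measure_lebesgue_on)
  have "(\<lambda>n. \<integral>x. (cmod (f x - h n x))\<^sup>2 \<partial>lebesgue_on S) \<longlonglongrightarrow> (\<integral>x. 0 \<partial>lebesgue_on S)"
  proof (rule integral_dominated_convergence[where w = "\<lambda>x. (2 * k)\<^sup>2"])
    have "AE x in lebesgue_on S. x \<notin> N"
      using N Sl by (simp add: AE_restrict_space_iff AE_I' negligible_iff_null_sets)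
        (metis (no_types, lifting) AE_not_in negligible_iff_null_sets eventually_mono)
    then show "AE x in lebesgue_on S. (\<lambda>n. (cmod (f x - h n x))\<^sup>2) \<longlonglongrightarrow> 0"
      using AE_space
    proof eventually_elim
      case (elim x)
      then have "x \<in> S" by simp
      have "(\<lambda>n. g n x) \<longlonglongrightarrow> f x" using lim[OF elim(1)] \<open>x \<in> S\<close> by simp
      moreover have "isCont cl (f x)" using cl_cont by (simp add: continuous_on_eq_continuous_at)
      ultimately have "(\<lambda>n. h n x) \<longlonglongrightarrow> cl (f x)"
        unfolding h_def using isCont_tendsto_compose by blast
      then have "(\<lambda>n. h n x) \<longlonglongrightarrow> f x" using cl_id bd \<open>x \<in> S\<close> by simp
      then have "(\<lambda>n. (cmod (f x - h n x))\<^sup>2) \<longlonglongrightarrow> (cmod (f x - f x))\<^sup>2"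
        by (intro tendsto_intros)
      then show ?case by simp
    qed
    show "AE x in lebesgue_on S. norm ((cmod (f x - h n x))\<^sup>2) \<le> (2 * k)\<^sup>2" for n
    proof (rule AE_I2)
      fix x assume "x \<in> space (lebesgue_on S)"
      then have "cmod (f x - h n x) \<le> 2 * k"
        using bd[of x] cl_bd[of "g n x"] norm_triangle_ineq4[of "f x" "h n x"] by (simp add: h_def)
      then show "norm ((cmod (f x - h n x))\<^sup>2) \<le> (2 * k)\<^sup>2"
        using power_mono[of "cmod (f x - h n x)" "2 * k" 2] by simp
    qed
  qed auto
  then have "(\<lambda>n. L2_norm S (\<lambda>x. f x - h n x)) \<longlonglongrightarrow> 0"
    unfolding L2_norm_def using tendsto_real_sqrt by fastforce
  from order_tendstoD(2)[OF this e] obtain n where "L2_norm S (\<lambda>x. f x - h n x) < e"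
    by (auto simp: eventually_sequentially)
  then show ?thesis using h by blast
qed

lemma L2_dense_continuous:
  assumes S: "compact S" and f: "f \<in> L2 S" and e: "e > 0"
  shows "\<exists>g. continuous_on UNIV g \<and> L2_norm S (\<lambda>x. f x - g x) < e"
proof -
  have Sm: "S \<in> lmeasurable" and Sl: "S \<in> sets lebesgue" using lmeasurable_compact[OF S] by auto
  note [measurable] = L2_D(1)[OF f]
  obtain k where k: "k > 0" and fk: "L2_norm S (\<lambda>x. f x - (if cmod (f x) \<le> k then f x else 0)) < e / 2"
    using L2_dense_bounded[OF f, of "e / 2"] e by auto
  define u where "u = (\<lambda>x. if cmod (f x) \<le> k then f x else 0)"
  have um: "u \<in> borel_measurable (lebesgue_on S)" unfolding u_def by measurable
  have ub: "cmod (u x) \<le> k" for x using k by (auto simp: u_def)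
  have uL: "u \<in> L2 S" using L2_bounded[OF Sm um ub] .
  obtain g where g: "continuous_on UNIV g" "L2_norm S (\<lambda>x. u x - g x) < e / 2"
    using L2_dense_continuous_of_bounded[OF Sm um ub k, of "e / 2"] e by auto
  have gL: "g \<in> L2 S" using g(1) S continuous_on_subset by (blast intro: L2_continuous)
  have "L2_norm S (\<lambda>x. (f x - u x) + (u x - g x)) \<le> L2_norm S (\<lambda>x. f x - u x) + L2_norm S (\<lambda>x. u x - g x)"
    by (intro L2_norm_triangle L2_diff f uL gL)
  then have "L2_norm S (\<lambda>x. f x - g x) < e"
    using fk g(2) by (simp add: u_def)
  then show ?thesis using g(1) by blast
qed

section \<open>Partial derivatives\<close>

text \<open>Total differentiability at every point, with the derivative recorded by its coordinates.
  Sum and product rules can then be composed syntactically, and \<open>partial_deriv\<close> of a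
  compound expression is read off by uniqueness.\<close>

definition has_partials ::
    "(real ^ 'd \<Rightarrow> complex) \<Rightarrow> ('d \<Rightarrow> real ^ 'd \<Rightarrow> complex) \<Rightarrow> bool" where
  "has_partials f f' \<longleftrightarrow>
     (\<forall>x. (f has_derivative (\<lambda>v. \<Sum>m\<in>UNIV. of_real (v $ m) * f' m x)) (at x))"

lemma has_partialsD:
  "has_partials f f' \<Longrightarrow> (f has_derivative (\<lambda>v. \<Sum>m\<in>UNIV. of_real (v $ m) * f' m x)) (at x)"
  by (simp add: has_partials_def)

lemma has_partials_unique:
  assumes "has_partials f f'"
  shows "partial_deriv m f = f' m"
proof
  fix x
  have "partial_deriv m f x = (\<Sum>n\<in>UNIV. of_real ((axis m 1 :: real ^ 'a) $ n) * f' n x)"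
    unfolding partial_deriv_def
    by (subst frechet_derivative_at[OF has_partialsD[OF assms, of x], symmetric]) simp
  also have "\<dots> = (\<Sum>n\<in>UNIV. if n = m then f' n x else 0)"
    by (rule sum.cong) (auto simp: axis_def)
  finally show "partial_deriv m f x = f' m x" by simp
qed

lemma has_partials_partial_deriv:
  assumes "\<And>x. f differentiable (at x)"
  shows "has_partials f (\<lambda>m. partial_deriv m f)"
  unfolding has_partials_def
proof
  fix x
  let ?D = "frechet_derivative f (at x)"
  have D: "(f has_derivative ?D) (at x)" using assms frechet_derivative_works by blast
  then have lin: "linear ?D" by (rule has_derivative_linear)
  have "?D v = (\<Sum>m\<in>UNIV. of_real (v $ m) * partial_deriv m f x)" for v
  proof -
    have "?D v = ?D (\<Sum>m\<in>UNIV. v $ m *\<^sub>R axis m 1)"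
      by (simp add: basis_expansion flip: scalar_mult_eq_scaleR)
    also have "\<dots> = (\<Sum>m\<in>UNIV. v $ m *\<^sub>R ?D (axis m 1))"
      by (simp add: linear_sum[OF lin] linear_scale[OF lin])
    finally show ?thesis by (simp add: partial_deriv_def scaleR_conv_of_real)
  qed
  then show "(f has_derivative (\<lambda>v. \<Sum>m\<in>UNIV. of_real (v $ m) * partial_deriv m f x)) (at x)"
    using D by (metis (no_types, lifting) ext)
qed

lemma has_partials_continuous: "has_partials f f' \<Longrightarrow> continuous_on S f"
  by (meson has_derivative_continuous has_partialsD continuous_at_imp_continuous_on)

lemma has_partials_const: "has_partials (\<lambda>x. c) (\<lambda>m x. 0)"
  by (simp add: has_partials_def)

lemma has_partials_coord: "has_partials (\<lambda>x. of_real (x $ k)) (\<lambda>m x. if m = k then 1 else 0)"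
proof -
  have "(\<Sum>m\<in>UNIV. complex_of_real (v $ m) * (if m = k then 1 else 0)) = of_real (v $ k)" for v :: "real ^ 'a"
    by (simp add: if_distrib cong: if_cong)
  moreover have "((\<lambda>x::real^'a. complex_of_real (x $ k)) has_derivative (\<lambda>v. of_real (v $ k))) (at x)" for x
    by (intro bounded_linear.has_derivative[OF bounded_linear_of_real]
        bounded_linear.has_derivative[OF bounded_linear_vec_nth] has_derivative_ident)
  ultimately show ?thesis by (simp add: has_partials_def)
qed

lemma has_partials_add:
  assumes "has_partials f f'" "has_partials g g'"
  shows "has_partials (\<lambda>x. f x + g x) (\<lambda>m x. f' m x + g' m x)"
  unfolding has_partials_def
  using has_derivative_add[OF has_partialsD[OF assms(1)] has_partialsD[OF assms(2)]]
  by (simp add: distrib_left sum.distrib)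

lemma has_partials_mult:
  assumes "has_partials f f'" "has_partials g g'"
  shows "has_partials (\<lambda>x. f x * g x) (\<lambda>m x. f' m x * g x + f x * g' m x)"
  unfolding has_partials_def
proof
  fix x
  have "((\<lambda>x. f x * g x) has_derivative
      (\<lambda>v. f x * (\<Sum>m\<in>UNIV. of_real (v $ m) * g' m x) + (\<Sum>m\<in>UNIV. of_real (v $ m) * f' m x) * g x)) (at x)"
    by (rule has_derivative_mult[OF has_partialsD[OF assms(1)] has_partialsD[OF assms(2)]])
  moreover have "f x * (\<Sum>m\<in>UNIV. of_real (v $ m) * g' m x) + (\<Sum>m\<in>UNIV. of_real (v $ m) * f' m x) * g x
      = (\<Sum>m\<in>UNIV. of_real (v $ m) * (f' m x * g x + f x * g' m x))" for v :: "real ^ 'a"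
    by (simp add: sum_distrib_left sum_distrib_right distrib_left sum.distrib mult_ac add.commute)
  ultimately show "((\<lambda>x. f x * g x) has_derivative
      (\<lambda>v. \<Sum>m\<in>UNIV. of_real (v $ m) * (f' m x * g x + f x * g' m x))) (at x)"
    by simp
qed

lemma has_partials_cmult:
  assumes "has_partials f f'"
  shows "has_partials (\<lambda>x. c * f x) (\<lambda>m x. c * f' m x)"
  using has_partials_mult[OF has_partials_const assms, of c] by simp

lemma has_partials_sum:
  assumes "finite I" "\<And>i. i \<in> I \<Longrightarrow> has_partials (f i) (f' i)"
  shows "has_partials (\<lambda>x. \<Sum>i\<in>I. f i x) (\<lambda>m x. \<Sum>i\<in>I. f' i m x)"
  using assms
  by (induction I rule: finite_induct) (auto intro: has_partials_const has_partials_add)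

lemma has_partials_cnj:
  assumes "has_partials f f'"
  shows "has_partials (\<lambda>x. cnj (f x)) (\<lambda>m x. cnj (f' m x))"
  unfolding has_partials_def
  using bounded_linear.has_derivative[OF bounded_linear_cnj has_partialsD[OF assms]]
  by simp

lemma has_partials_exp:
  assumes "has_partials f f'"
  shows "has_partials (\<lambda>x. exp (f x)) (\<lambda>m x. f' m x * exp (f x))"
  unfolding has_partials_def
proof
  fix x
  have "((\<lambda>x. exp (f x)) has_derivative (\<lambda>v. exp (f x) * (\<Sum>m\<in>UNIV. of_real (v $ m) * f' m x))) (at x)"
    using has_derivative_compose[OF has_partialsD[OF assms]
        has_field_derivative_imp_has_derivative[OF DERIV_exp]]
    by simp
  then show "((\<lambda>x. exp (f x)) has_derivative (\<lambda>v. \<Sum>m\<in>UNIV. of_real (v $ m) * (f' m x * exp (f x)))) (at x)"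
    by (simp add: sum_distrib_left mult_ac)
qed

lemma C2_I:
  assumes f: "has_partials f f'" and f': "\<And>m. has_partials (f' m) (f'' m)"
    and f'': "\<And>m n. continuous_on UNIV (f'' m n)"
  shows "C2 f"
proof -
  have "f differentiable_on UNIV"
    using has_partialsD[OF f] by (auto simp: differentiable_on_def differentiable_def)
  moreover have "partial_deriv m f differentiable_on UNIV" for m
    using has_partialsD[OF f', of m] has_partials_unique[OF f]
    by (auto simp: differentiable_on_def differentiable_def)
  ultimately show ?thesis
    unfolding C2_def using has_partials_unique[OF f] has_partials_unique[OF f'] f'' by simp
qed

lemma C2_D:
  assumes "C2 f"
  shows "has_partials f (\<lambda>m. partial_deriv m f)"
    "has_partials (partial_deriv m f) (\<lambda>n. partial_deriv n (partial_deriv m f))"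
    "continuous_on UNIV (partial_deriv n (partial_deriv m f))"
  using assms has_partials_partial_deriv unfolding C2_def by (auto simp: differentiable_on_def)

section \<open>Polynomials\<close>

text \<open>\<open>poly_lt n p\<close> says that \<open>p\<close> is a polynomial of total degree less than \<open>n\<close>; counting strictly
  makes differentiation lower the index by one without exception at \<open>n = 0\<close>.\<close>

inductive poly_lt :: "nat \<Rightarrow> (real ^ 'd \<Rightarrow> complex) \<Rightarrow> bool" where
  poly_lt_zero: "poly_lt n (\<lambda>x. 0)"
| poly_lt_const: "poly_lt (Suc n) (\<lambda>x. c)"
| poly_lt_coord: "poly_lt n p \<Longrightarrow> poly_lt (Suc n) (\<lambda>x. of_real (x $ k) * p x)"
| poly_lt_add: "poly_lt n p \<Longrightarrow> poly_lt n q \<Longrightarrow> poly_lt n (\<lambda>x. p x + q x)"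

lemma poly_lt_0: "poly_lt 0 p \<Longrightarrow> p = (\<lambda>x. 0)"
  by (induction "0::nat" p rule: poly_lt.induct) auto

lemma poly_lt_Suc: "poly_lt n p \<Longrightarrow> poly_lt (Suc n) p"
  by (induction rule: poly_lt.induct) (auto intro: poly_lt.intros)

lemma poly_lt_mono: "n \<le> m \<Longrightarrow> poly_lt n p \<Longrightarrow> poly_lt m p"
  by (induction m rule: dec_induct) (auto intro: poly_lt_Suc)

lemma poly_lt_cmult: "poly_lt n p \<Longrightarrow> poly_lt n (\<lambda>x. c * p x)"
proof (induction rule: poly_lt.induct)
  case (poly_lt_const n d)
  show ?case by (rule poly_lt.poly_lt_const)
next
  case (poly_lt_coord n p k)
  from poly_lt.poly_lt_coord[OF this(2), of k] show ?case by (simp add: mult.left_commute)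
qed (auto simp: distrib_left intro: poly_lt.intros)

text \<open>At \<open>n = 0\<close> truncated subtraction leaves \<open>poly_lt 0 p\<close>, which
  forces \<open>p\<close> to be zero, so the rule undoes one differentiation for every
  \<open>n\<close>.\<close>

lemma poly_lt_coord_pred: "poly_lt (n - 1) p \<Longrightarrow> poly_lt n (\<lambda>x. of_real (x $ k) * p x)"
  by (cases n) (use poly_lt_0[of p] poly_lt_zero in \<open>auto intro: poly_lt.intros\<close>)

lemma poly_lt_sum:
  "finite I \<Longrightarrow> (\<And>i. i \<in> I \<Longrightarrow> poly_lt n (p i)) \<Longrightarrow> poly_lt n (\<lambda>x. \<Sum>i\<in>I. p i x)"
  by (induction I rule: finite_induct) (auto intro: poly_lt.intros)

lemma poly_lt_mult: "poly_lt n p \<Longrightarrow> poly_lt m q \<Longrightarrow> poly_lt (n + m) (\<lambda>x. p x * q x)"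
proof (induction rule: poly_lt.induct)
  case (poly_lt_const n c)
  then show ?case by (auto intro: poly_lt_cmult poly_lt_mono[of m])
next
  case (poly_lt_coord n p k)
  then show ?case using poly_lt.poly_lt_coord[of "n + m" "\<lambda>x. p x * q x" k] by (simp add: mult.assoc)
qed (auto simp: distrib_right intro: poly_lt.intros)

lemma poly_lt_has_partials:
  "poly_lt n p \<Longrightarrow> \<exists>p'. has_partials p p' \<and> (\<forall>m. poly_lt (n - 1) (p' m))"
proof (induction rule: poly_lt.induct)
  case (poly_lt_coord n p k)
  then obtain p' where p': "has_partials p p'" "\<And>m. poly_lt (n - 1) (p' m)" by blast
  have "poly_lt n (\<lambda>x. (if m = k then 1 else 0) * p x + of_real (x $ k) * p' m x)" for m
    using poly_lt_coord(1) poly_lt_coord_pred[OF p'(2)[of m], of k]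
    by (cases "m = k") (auto intro: poly_lt.intros)
  then show ?case using has_partials_mult[OF has_partials_coord p'(1), of k] by auto
next
  case (poly_lt_add n p q)
  then obtain p' q' where "has_partials p p'" "\<And>m. poly_lt (n - 1) (p' m)"
    "has_partials q q'" "\<And>m. poly_lt (n - 1) (q' m)" by blast
  then show ?case
    by (intro exI[of _ "\<lambda>m x. p' m x + q' m x"]) (auto intro: has_partials_add poly_lt.intros)
qed (auto intro!: exI[of _ "\<lambda>m x. 0"] has_partials_const poly_lt.intros)

lemma poly_lt_partial_deriv:
  assumes "poly_lt n p"
  shows "has_partials p (\<lambda>m. partial_deriv m p)" "poly_lt (n - 1) (partial_deriv m p)"
proof -
  obtain p' where p': "has_partials p p'" "\<And>m. poly_lt (n - 1) (p' m)"
    using poly_lt_has_partials[OF assms] by blast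
  have "(\<lambda>m. partial_deriv m p) = p'" using has_partials_unique[OF p'(1)] by blast
  then show "has_partials p (\<lambda>m. partial_deriv m p)" "poly_lt (n - 1) (partial_deriv m p)"
    using p' by simp_all (metis (full_types))
qed

lemma poly_lt_continuous: "poly_lt n p \<Longrightarrow> continuous_on S p"
  by (meson has_partials_continuous poly_lt_partial_deriv)

lemma poly_lt_C2: "poly_lt n p \<Longrightarrow> C2 p"
  by (rule C2_I[where f' = "\<lambda>m. partial_deriv m p" and f'' = "\<lambda>m n. partial_deriv n (partial_deriv m p)"])
    (auto intro: poly_lt_partial_deriv poly_lt_continuous)

section \<open>Finite-dimensionality and density of polynomials\<close>

inductive lin_span :: "('a \<Rightarrow> complex) set \<Rightarrow> ('a \<Rightarrow> complex) \<Rightarrow> bool" for B where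
  lin_span_zero: "lin_span B (\<lambda>x. 0)"
| lin_span_base: "b \<in> B \<Longrightarrow> lin_span B (\<lambda>x. c * b x)"
| lin_span_add: "lin_span B f \<Longrightarrow> lin_span B g \<Longrightarrow> lin_span B (\<lambda>x. f x + g x)"

lemma lin_span_finite:
  assumes "lin_span B f" "finite B"
  shows "\<exists>c. f = (\<lambda>x. \<Sum>b\<in>B. c b * b x)"
  using assms
proof (induction rule: lin_span.induct)
  case lin_span_zero
  then show ?case by (intro exI[of _ "\<lambda>b. 0"]) simp
next
  case (lin_span_base b c)
  have "(\<Sum>b'\<in>B. (if b' = b then c else 0) * b' x) = c * b x" for x
  proof -
    have "(\<Sum>b'\<in>B. (if b' = b then c else 0) * b' x) = (\<Sum>b'\<in>B. if b' = b then c * b' x else 0)"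
      by (rule sum.cong) auto
    then show ?thesis using lin_span_base by simp
  qed
  then show ?case by (intro exI[of _ "\<lambda>b'. if b' = b then c else 0"]) simp
next
  case (lin_span_add f g)
  then obtain c d where "f = (\<lambda>x. \<Sum>b\<in>B. c b * b x)" "g = (\<lambda>x. \<Sum>b\<in>B. d b * b x)" by blast
  then show ?case
    by (intro exI[of _ "\<lambda>b. c b + d b"]) (simp add: distrib_right sum.distrib)
qed

lemma lin_span_mult:
  assumes "lin_span B f" "\<And>b. b \<in> B \<Longrightarrow> (\<lambda>x. h x * b x) \<in> B'"
  shows "lin_span B' (\<lambda>x. h x * f x)"
  using assms(1)
proof (induction rule: lin_span.induct)
  case (lin_span_base b c)
  then show ?case using lin_span.lin_span_base[OF assms(2), of b c] by (simp add: mult.left_commute)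
qed (auto simp: distrib_left intro: lin_span.intros)

text \<open>Generators for the next degree are the constant 1 and every coordinate times every old
  generator, that is, monomials.\<close>

lemma poly_lt_finite_basis:
  "\<exists>B. finite B \<and> B \<subseteq> Collect (poly_lt n) \<and> (\<forall>p. poly_lt n p \<longrightarrow> lin_span B p)"
proof (induction n)
  case 0
  then show ?case by (intro exI[of _ "{}"]) (auto dest!: poly_lt_0 intro: lin_span.intros)
next
  case (Suc n)
  then obtain B :: "(real ^ 'a \<Rightarrow> complex) set"
    where B: "finite B" "B \<subseteq> Collect (poly_lt n)" "\<And>p. poly_lt n p \<Longrightarrow> lin_span B p" by blast
  define B' where "B' = insert (\<lambda>x. 1) (\<Union>k. (\<lambda>b x. of_real (x $ k) * b x) ` B)"
  have "finite B'" using B(1) by (auto simp: B'_def)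
  moreover have "B' \<subseteq> Collect (poly_lt (Suc n))"
    using B(2) by (auto simp: B'_def intro: poly_lt.intros)
  moreover have "lin_span B' p" if "poly_lt k p" "k = Suc n" for p k
    using that
  proof (induction rule: poly_lt.induct)
    case (poly_lt_const n' c)
    have "lin_span B' (\<lambda>x. c * (\<lambda>x. 1) x)" by (rule lin_span_base) (simp add: B'_def)
    then show ?case by simp
  next
    case (poly_lt_coord n' p k)
    then show ?case by (intro lin_span_mult[OF B(3)]) (auto simp: B'_def)
  qed (auto intro: lin_span.intros)
  ultimately show ?case by blast
qed

lemma poly_lt_dense_continuous:
  fixes g :: "real ^ 'd \<Rightarrow> real"
  assumes S: "compact S" and g: "continuous_on S g" and e: "e > 0"
  shows "\<exists>n p. poly_lt n p \<and> (\<forall>x\<in>S. cmod (of_real (g x) - p x) < e)"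
proof -
  define P :: "(real ^ 'd \<Rightarrow> real) \<Rightarrow> bool" where "P = (\<lambda>f. \<exists>n. poly_lt n (\<lambda>x. complex_of_real (f x)))"
  have "\<exists>f. P f \<and> (\<forall>x\<in>S. \<bar>g x - f x\<bar> < e)"
  proof (rule Stone_Weierstrass_HOL[of S P])
    show "P (\<lambda>x. c)" for c unfolding P_def using poly_lt_const by blast
    show "continuous_on S f" if "P f" for f
    proof -
      obtain n where "poly_lt n (\<lambda>x. complex_of_real (f x))"
        using \<open>P f\<close> unfolding P_def by blast
      then have "continuous_on S (\<lambda>x. Re (complex_of_real (f x)))"
        by (intro continuous_intros poly_lt_continuous)
      then show ?thesis by simp
    qed
    show "P (\<lambda>x. f x + h x)" if "P f \<and> P h" for f h
    proof -
      obtain n m where "poly_lt n (\<lambda>x. complex_of_real (f x))" "poly_lt m (\<lambda>x. complex_of_real (h x))"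
        using \<open>P f \<and> P h\<close> unfolding P_def by blast
      then have "poly_lt (max n m) (\<lambda>x. complex_of_real (f x))" "poly_lt (max n m) (\<lambda>x. complex_of_real (h x))"
        by (auto intro: poly_lt_mono[rotated])
      then show ?thesis unfolding P_def using poly_lt_add by fastforce
    qed
    show "P (\<lambda>x. f x * h x)" if "P f \<and> P h" for f h
      using that poly_lt_mult unfolding P_def by fastforce
    show "\<exists>f. P f \<and> f x \<noteq> f y" if "x \<in> S \<and> y \<in> S \<and> x \<noteq> y" for x y
    proof -
      obtain k where k: "x $ k \<noteq> y $ k"
        using \<open>x \<in> S \<and> y \<in> S \<and> x \<noteq> y\<close> by (auto simp: vec_eq_iff)
      have "P (\<lambda>x. x $ k)" unfolding P_def using poly_lt_coord[OF poly_lt_const[of 0 1], of k] by auto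
      then show ?thesis using k by blast
    qed
  qed (use S g e in auto)
  then obtain f n where f: "poly_lt n (\<lambda>x. complex_of_real (f x))" "\<And>x. x \<in> S \<Longrightarrow> \<bar>g x - f x\<bar> < e"
    by (auto simp: P_def)
  then show ?thesis
    by (intro exI[of _ n] exI[of _ "\<lambda>x. complex_of_real (f x)"]) (simp flip: of_real_diff)
qed

lemma L2_dense_poly:
  fixes f :: "real ^ 'd \<Rightarrow> complex"
  assumes S: "compact S" and f: "f \<in> L2 S" and e: "e > 0"
  shows "\<exists>n p. poly_lt n p \<and> L2_norm S (\<lambda>x. f x - p x) < e"
proof -
  have Sm: "S \<in> lmeasurable" "S \<in> sets lebesgue" using lmeasurable_compact[OF S] by auto
  obtain g where g: "continuous_on UNIV g" "L2_norm S (\<lambda>x. f x - g x) < e / 2"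
    using L2_dense_continuous[OF S f, of "e / 2"] e by auto
  have gS: "continuous_on S g" using g(1) continuous_on_subset by blast
  \<comment> \<open>The summand 1 keeps \<open>M\<close> positive when \<open>S\<close> is null. The
    errors of real and imaginary part add up to \<open>2 * d\<close>, and \<open>2 * d * M\<close>
    is half of \<open>e\<close>.\<close>
  define M where "M = sqrt (measure lebesgue S) + 1"
  have M: "M > 0" by (simp add: M_def add_nonneg_pos)
  define d where "d = e / (4 * M)"
  have d: "d > 0" using e M by (simp add: d_def)
  obtain n p where p: "poly_lt n p" "\<And>x. x \<in> S \<Longrightarrow> cmod (of_real (Re (g x)) - p x) < d"
    using poly_lt_dense_continuous[OF S continuous_on_Re[OF gS] d] by blast
  obtain m q where q: "poly_lt m q" "\<And>x. x \<in> S \<Longrightarrow> cmod (of_real (Im (g x)) - q x) < d"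
    using poly_lt_dense_continuous[OF S continuous_on_Im[OF gS] d] by blast
  define r where "r = (\<lambda>x. p x + \<i> * q x)"
  have r: "poly_lt (max n m) r"
    unfolding r_def
    using poly_lt_mono[OF _ p(1), of "max n m"] poly_lt_mono[OF _ poly_lt_cmult[OF q(1)], of "max n m" \<i>]
    by (intro poly_lt_add) auto
  have rc: "continuous_on S r" using r by (rule poly_lt_continuous)
  have "cmod (g x - r x) \<le> 2 * d" if x: "x \<in> S" for x
  proof -
    have "g x - r x = (of_real (Re (g x)) - p x) + \<i> * (of_real (Im (g x)) - q x)"
      unfolding r_def by (subst (1) complex_eq[of "g x"]) (simp add: algebra_simps)
    then have "cmod (g x - r x) \<le> cmod (of_real (Re (g x)) - p x) + cmod (of_real (Im (g x)) - q x)"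
      by (metis norm_triangle_ineq norm_mult norm_ii mult_1)
    then show ?thesis using p(2)[OF x] q(2)[OF x] by simp
  qed
  then have "L2_norm S (\<lambda>x. g x - r x) \<le> 2 * d * sqrt (measure lebesgue S)"
    using d Sm gS rc
    by (intro L2_norm_bounded borel_measurable_continuous_lebesgue_on continuous_intros) auto
  also have "\<dots> \<le> 2 * d * M" using d by (intro mult_left_mono) (auto simp: M_def)
  also have "\<dots> = e / 2" using M by (simp add: d_def)
  finally have "L2_norm S (\<lambda>x. g x - r x) \<le> e / 2" .
  moreover have "L2_norm S (\<lambda>x. (f x - g x) + (g x - r x)) \<le> L2_norm S (\<lambda>x. f x - g x) + L2_norm S (\<lambda>x. g x - r x)"
    by (intro L2_norm_triangle L2_diff f L2_continuous S gS rc)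
  ultimately have "L2_norm S (\<lambda>x. f x - r x) < e" using g(2) by simp
  then show ?thesis using r by blast
qed

section \<open>The divergence theorem on ellipsoids\<close>

text \<open>Defining function of the domain centred at 0, and at the same time the common factor of
  the diagonal coefficients; it is used with (a, b) in space and with (\<alpha>, \<beta>) in
  frequency.\<close>

definition quadric :: "real ^ 'd \<Rightarrow> real \<Rightarrow> real ^ 'd \<Rightarrow> real" where
  "quadric a b x = (\<Sum>n\<in>UNIV. a $ n * (x $ n)\<^sup>2) - b"

lemma quadratic_domain_0: "quadratic_domain 0 a b = {x. quadric a b x \<le> 0}"
  by (simp add: quadratic_domain_def quadric_def mult.commute)

lemma continuous_on_quadric [continuous_intros]: "continuous_on S (quadric a b)"
  unfolding quadric_def by (intro continuous_intros)

lemma closed_quadratic_domain: "closed (quadratic_domain 0 a b)"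
  unfolding quadratic_domain_0
  by (intro closed_Collect_le continuous_on_quadric continuous_on_const)

lemma compact_quadratic_domain:
  fixes a :: "real ^ 'd"
  assumes a: "\<And>m. a $ m > 0"
  shows "compact (quadratic_domain 0 a b)"
proof -
  define k where "k = Min (range (\<lambda>m. a $ m))"
  have k: "k > 0" "\<And>m. k \<le> a $ m" using a by (auto simp: k_def)
  have "norm x \<le> sqrt (b / k)" if "x \<in> quadratic_domain 0 a b" for x
  proof -
    have "k * (x \<bullet> x) = (\<Sum>m\<in>UNIV. k * (x $ m)\<^sup>2)"
      by (simp add: inner_vec_def sum_distrib_left power2_eq_square)
    also have "\<dots> \<le> (\<Sum>m\<in>UNIV. a $ m * (x $ m)\<^sup>2)" by (intro sum_mono mult_right_mono k) auto
    also have "\<dots> \<le> b" using that by (simp add: quadratic_domain_0 quadric_def)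
    finally show ?thesis using k(1) by (simp add: norm_eq_sqrt_inner field_simps)
  qed
  then have "bounded (quadratic_domain 0 a b)" by (auto simp: bounded_iff)
  then show ?thesis using closed_quadratic_domain compact_eq_bounded_closed by blast
qed

text \<open>The zero set lies in the image of a sphere under the linear rescaling of the axes by
  \<open>1 / sqrt (a $ m)\<close>.\<close>

lemma negligible_quadric_eq_0:
  fixes a :: "real ^ 'd"
  assumes a: "\<And>m. a $ m > 0"
  shows "negligible {x. quadric a b x = 0}"
proof -
  define f :: "real ^ 'd \<Rightarrow> real ^ 'd" where "f = (\<lambda>y. \<chi> m. y $ m / sqrt (a $ m))"
  have "linear f" by (rule linearI) (auto simp: f_def vec_eq_iff add_divide_distrib)
  then have "negligible (f ` sphere 0 (sqrt b))"
    by (intro negligible_differentiable_image_negligible negligible_sphere linear_imp_differentiable_on) simp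
  moreover have "{x. quadric a b x = 0} \<subseteq> f ` sphere 0 (sqrt b)"
  proof
    fix x assume "x \<in> {x. quadric a b x = 0}"
    then have b: "(\<Sum>m\<in>UNIV. a $ m * (x $ m)\<^sup>2) = b" by (simp add: quadric_def)
    define y :: "real ^ 'd" where "y = (\<chi> m. sqrt (a $ m) * x $ m)"
    have "y \<bullet> y = (\<Sum>m\<in>UNIV. (sqrt (a $ m))\<^sup>2 * (x $ m)\<^sup>2)"
      unfolding y_def inner_vec_def by (simp add: power2_eq_square algebra_simps)
    also have "\<dots> = b" using a by (simp add: b less_imp_le)
    finally have "y \<in> sphere 0 (sqrt b)" by (simp add: norm_eq_sqrt_inner)
    moreover have "x = f y" using a by (simp add: f_def y_def vec_eq_iff less_imp_neq[symmetric])
    ultimately show "x \<in> f ` sphere 0 (sqrt b)" by blast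
  qed
  ultimately show ?thesis using negligible_subset by blast
qed

lemma has_partials_quadric:
  "has_partials (\<lambda>x. of_real (quadric a b x)) (\<lambda>m x. of_real (2 * a $ m * x $ m))"
proof -
  have "has_partials (\<lambda>x. complex_of_real (a $ n) * (of_real (x $ n) * of_real (x $ n)))
      (\<lambda>m x. of_real (a $ n) * ((if m = n then 1 else 0) * of_real (x $ n)
        + of_real (x $ n) * (if m = n then 1 else 0)))" for n
    by (intro has_partials_cmult has_partials_mult has_partials_coord)
  \<comment> \<open>Function and partials are rewritten together, as one pair.\<close>
  then have 1: "has_partials (\<lambda>x. complex_of_real (a $ n * (x $ n)\<^sup>2))
      (\<lambda>m x. if m = n then of_real (2 * a $ m * x $ m) else 0)" for n
    by (rule back_subst[of "\<lambda>(f, f'). has_partials f f'" "(_, _)" "(_, _)", simplified])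
      (auto simp: fun_eq_iff power2_eq_square)
  have "has_partials (\<lambda>x. (\<Sum>n\<in>UNIV. complex_of_real (a $ n * (x $ n)\<^sup>2)) + of_real (- b))
      (\<lambda>m x. (\<Sum>n\<in>UNIV. if m = n then of_real (2 * a $ m * x $ m) else 0) + 0)"
    by (intro has_partials_add has_partials_sum has_partials_const 1) auto
  then show ?thesis by (simp add: quadric_def)
qed

section \<open>Difference quotients and integration of derivatives\<close>

lemma has_partials_quotient_tendsto:
  fixes x :: "real ^ 'd"
  assumes F: "has_partials F F'" and t: "t \<longlonglongrightarrow> 0" "\<And>n. t n > 0"
  shows "(\<lambda>n. (F (x + t n *\<^sub>R axis m 1) - F x) / of_real (t n)) \<longlonglongrightarrow> F' m x"
proof -
  define e :: "real ^ 'd" where "e = axis m 1"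
  define D where "D = (\<lambda>v::real ^ 'd. \<Sum>k\<in>UNIV. of_real (v $ k) * F' k x)"
  have De: "D (s *\<^sub>R e) = of_real s * F' m x" for s
  proof -
    have "D (s *\<^sub>R e) = (\<Sum>k\<in>UNIV. if k = m then of_real s * F' k x else 0)"
      unfolding D_def by (rule sum.cong) (auto simp: e_def axis_def)
    then show ?thesis by simp
  qed
  have "((\<lambda>h. norm (F (x + h) - F x - D h) / norm h) \<longlongrightarrow> 0) (at 0)"
    using has_partialsD[OF F, of x] unfolding has_derivative_at D_def by blast
  moreover have "filterlim (\<lambda>n. t n *\<^sub>R e) (at 0) sequentially"
    unfolding filterlim_at using t(2) tendsto_scaleR[OF t(1) tendsto_const, of e]
    by (auto simp: e_def axis_eq_0_iff order_less_imp_not_eq2)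
  ultimately have "(\<lambda>n. norm (F (x + t n *\<^sub>R e) - F x - D (t n *\<^sub>R e)) / norm (t n *\<^sub>R e)) \<longlonglongrightarrow> 0"
    by (rule filterlim_compose)
  moreover have "norm (F (x + t n *\<^sub>R e) - F x - D (t n *\<^sub>R e)) / norm (t n *\<^sub>R e)
      = norm ((F (x + t n *\<^sub>R e) - F x) / of_real (t n) - F' m x)" for n
  proof -
    have "(F (x + t n *\<^sub>R e) - F x) / of_real (t n) - F' m x
        = (F (x + t n *\<^sub>R e) - F x - D (t n *\<^sub>R e)) / of_real (t n)"
      using t(2)[of n] by (simp add: De field_simps)
    then show ?thesis using t(2)[of n] by (simp add: norm_divide e_def)
  qed
  ultimately have "(\<lambda>n. (F (x + t n *\<^sub>R e) - F x) / of_real (t n) - F' m x) \<longlonglongrightarrow> 0"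
    by (simp add: tendsto_norm_zero_iff)
  then show ?thesis unfolding e_def by (rule LIM_zero_cancel)
qed

text \<open>Mean value inequality along a coordinate line: only the partial in that direction, on
  that segment, has to be bounded.\<close>

lemma has_partials_line_bound:
  fixes x :: "real ^ 'd"
  assumes h: "has_partials h h'" and t: "t \<ge> 0"
    and B: "\<And>s. 0 \<le> s \<Longrightarrow> s \<le> t \<Longrightarrow> cmod (h' m (x + s *\<^sub>R axis m 1)) \<le> B"
  shows "cmod (h (x + t *\<^sub>R axis m 1) - h x) \<le> B * t"
proof -
  define e :: "real ^ 'd" where "e = axis m 1"
  have D: "(\<Sum>k\<in>UNIV. of_real ((s *\<^sub>R e) $ k) * h' k y) = s *\<^sub>R h' m y" for s y
  proof -
    have "(\<Sum>k\<in>UNIV. of_real ((s *\<^sub>R e) $ k) * h' k y) = (\<Sum>k\<in>UNIV. if k = m then of_real s * h' k y else 0)"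
      by (rule sum.cong) (auto simp: e_def axis_def)
    then show ?thesis by (simp add: scaleR_conv_of_real[of s "h' m y"])
  qed
  have "norm ((\<lambda>s. h (x + s *\<^sub>R e)) t - (\<lambda>s. h (x + s *\<^sub>R e)) 0) \<le> B * norm (t - 0)"
  proof (rule differentiable_bound[where S = "{0..t}" and f' = "\<lambda>s r. r *\<^sub>R h' m (x + s *\<^sub>R e)"])
    fix s assume s: "s \<in> {0..t}"
    have "((\<lambda>s. x + s *\<^sub>R e) has_derivative (\<lambda>r. r *\<^sub>R e)) (at s within {0..t})"
      by (auto intro!: derivative_eq_intros)
    from has_derivative_compose[OF this has_partialsD[OF h]]
    show "((\<lambda>s. h (x + s *\<^sub>R e)) has_derivative (\<lambda>r. r *\<^sub>R h' m (x + s *\<^sub>R e))) (at s within {0..t})"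
      by (simp only: D)
    show "onorm (\<lambda>r::real. r *\<^sub>R h' m (x + s *\<^sub>R e)) \<le> B"
      using B[of s] s by (intro onorm_le) (auto simp: e_def mult.commute[of B] intro: mult_left_mono)
  qed (use t in auto)
  then show ?thesis using t by (simp add: e_def)
qed

text \<open>Trades the completed measure restricted to \<open>Q\<close> for \<open>lborel\<close>
  with an indicator, the setting for translation invariance and dominated convergence below.\<close>

lemma integral_lebesgue_on_eq_lborel:
  fixes f :: "'a::euclidean_space \<Rightarrow> complex"
  assumes Q: "Q \<in> sets borel" and f: "f \<in> borel_measurable borel"
  shows "(\<integral>x. f x \<partial>lebesgue_on Q) = (\<integral>x. indicator Q x *\<^sub>R f x \<partial>lborel)"
proof -
  have "(\<integral>x. f x \<partial>lebesgue_on Q) = (\<integral>x. indicator Q x *\<^sub>R f x \<partial>lebesgue)"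
    using Q by (subst integral_restrict_space) auto
  also have "\<dots> = (\<integral>x. indicator Q x *\<^sub>R f x \<partial>lborel)"
  proof (rule integral_completion)
    note [measurable] = Q f
    show "(\<lambda>x. indicator Q x *\<^sub>R f x) \<in> borel_measurable lborel" by measurable
  qed
  finally show ?thesis .
qed

text \<open>The divergence theorem for a vector field vanishing on the boundary: the extension by zero
  \<open>min (quadric a b) 0 * h\<close> is Lipschitz, and the integrals of its difference quotients vanish by
  translation invariance of Lebesgue measure.\<close>

lemma integral_partial_quadric:
  fixes a :: "real ^ 'd"
  assumes a: "\<And>m. a $ m > 0" and h: "has_partials h h'" and h': "continuous_on UNIV (h' m)"
  shows "(\<integral>x. of_real (2 * a $ m * x $ m) * h x + of_real (quadric a b x) * h' m x
            \<partial>lebesgue_on (quadratic_domain 0 a b)) = 0"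
proof -
  define Q where "Q = quadratic_domain 0 a b"
  have Q: "compact Q" "closed Q" "Q \<in> sets borel" "Q = {x. quadric a b x \<le> 0}"
    unfolding Q_def using compact_quadratic_domain[OF a, of b] closed_quadratic_domain[of a b]
    by (auto simp: quadratic_domain_0[of a b, symmetric] borel_closed)
  define e :: "real ^ 'd" where "e = axis m 1"
  have ne: "norm e = 1" by (simp add: e_def)
  define t where "t = (\<lambda>n. 1 / real (Suc n))"
  have t: "t \<longlonglongrightarrow> 0" "\<And>n. t n > 0" "\<And>n. t n \<le> 1"
    unfolding t_def using LIMSEQ_inverse_real_of_nat by (auto simp: inverse_eq_divide)
  define F' where "F' = (\<lambda>k x. of_real (2 * a $ k * x $ k) * h x + of_real (quadric a b x) * h' k x)"
  have F: "has_partials (\<lambda>x. of_real (quadric a b x) * h x) F'"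
    unfolding F'_def by (intro has_partials_mult has_partials_quadric h)
  define G where "G = (\<lambda>x. of_real (min (quadric a b x) 0) * h x)"
  have hc: "continuous_on S h" for S using h by (rule has_partials_continuous)
  have Gc: "continuous_on S G" for S
    unfolding G_def by (intro continuous_intros hc)
  have G0: "G x = 0" if "x \<notin> Q" for x using that by (simp add: G_def Q(4))
  have F'c: "continuous_on UNIV (F' m)"
    unfolding F'_def by (intro continuous_intros hc h')
  define D where "D = (\<lambda>n x. (G (x + t n *\<^sub>R e) - G x) / of_real (t n))"

  have Gint: "integrable lborel G"
  proof -
    have "integrable lborel (\<lambda>x. indicator Q x *\<^sub>R G x)"
      using Q(1) Gc by (rule borel_integrable_compact)
    moreover have "(\<lambda>x. indicator Q x *\<^sub>R G x) = G"
      using G0 by (auto simp: fun_eq_iff indicator_def)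
    ultimately show ?thesis by simp
  qed
  have trans: "integrable lborel (\<lambda>x. G (x + v))" "(\<integral>x. G (x + v) \<partial>lborel) = (\<integral>x. G x \<partial>lborel)" for v
  proof -
    have Gm: "G \<in> borel_measurable borel" using Gc by (rule borel_measurable_continuous_onI)
    have d: "distr lborel borel ((+) v) = lborel" by (rule lborel_distr_plus)
    have "integrable (distr lborel borel ((+) v)) G" using Gint by (simp add: d)
    then show "integrable lborel (\<lambda>x. G (x + v))"
      using Gm by (subst (asm) integrable_distr_eq) (auto simp: add.commute)
    have "(\<integral>x. G x \<partial>lborel) = (\<integral>x. G x \<partial>distr lborel borel ((+) v))" by (simp add: d)
    also have "\<dots> = (\<integral>x. G (x + v) \<partial>lborel)"
      using Gm by (subst integral_distr) (auto simp: add.commute)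
    finally show "(\<integral>x. G (x + v) \<partial>lborel) = (\<integral>x. G x \<partial>lborel)" ..
  qed
  have D0: "(\<integral>x. D n x \<partial>lborel) = 0" for n
    unfolding D_def using trans[of "t n *\<^sub>R e"] Gint by simp

  obtain R where R: "\<And>x. x \<in> Q \<Longrightarrow> norm x \<le> R"
    using compact_imp_bounded[OF Q(1)] by (auto simp: bounded_iff)
  \<comment> \<open>The quotients vanish outside the ball of radius \<open>R + 1\<close>, and shifts
    have length at most 1, so \<open>B\<close> contains all the segments that matter.\<close>
  define B :: "(real ^ 'd) set" where "B = cball 0 (R + 2)"
  have bdd: "\<exists>K. \<forall>x\<in>B. cmod (f x) \<le> K" if "continuous_on UNIV f" for f :: "real ^ 'd \<Rightarrow> complex"
  proof -
    have "compact (f ` B)" using that unfolding B_def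
      by (intro compact_continuous_image compact_cball) (auto intro: continuous_on_subset)
    then show ?thesis using compact_imp_bounded by (fastforce simp: bounded_iff)
  qed
  obtain H where H: "\<And>x. x \<in> B \<Longrightarrow> cmod (h x) \<le> H" using bdd[OF hc] by blast
  obtain H' where H': "\<And>x. x \<in> B \<Longrightarrow> cmod (h' m x) \<le> H'" using bdd[OF h'] by blast
  obtain P where P: "\<And>x. x \<in> B \<Longrightarrow> cmod (of_real (quadric a b x)) \<le> P"
    using bdd[of "\<lambda>x. of_real (quadric a b x)"] by (auto intro!: continuous_intros)
  \<comment> \<open>A Lipschitz constant of \<open>G\<close> in direction \<open>e\<close>, from the
    product rule: the quadric changes by \<open>a $ m * (2 * x $ m + t) * t\<close>, while
    \<open>h\<close> is at most \<open>H\<close>; and \<open>h\<close> changes by at most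
    \<open>H' * t\<close>, while the quadric is at most \<open>P\<close>.\<close>
  define K where "K = a $ m * (2 * \<bar>R + 1\<bar> + 1) * H + P * H'"
  have Dbound: "cmod (D n x) \<le> indicator (cball 0 (R + 1)) x * K" for n x
  proof (cases "x \<in> cball 0 (R + 1)")
    case False
    have "x + t n *\<^sub>R e \<notin> Q" "x \<notin> Q"
    proof -
      have "norm x \<le> norm (x + t n *\<^sub>R e) + norm (t n *\<^sub>R e)"
        by (metis add_diff_cancel norm_triangle_ineq4)
      also have "norm (t n *\<^sub>R e) \<le> 1" using t(2,3)[of n] by (simp add: ne)
      finally show "x + t n *\<^sub>R e \<notin> Q" using R[of "x + t n *\<^sub>R e"] False by auto
      show "x \<notin> Q" using R[of x] False by auto
    qed
    then show ?thesis using False by (simp add: D_def G0)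
  next
    case True
    let ?y = "x + t n *\<^sub>R e"
    have seg: "x + s *\<^sub>R e \<in> B" if "0 \<le> s" "s \<le> t n" for s
      using norm_triangle_ineq[of x "s *\<^sub>R e"] True that t(3)[of n] by (auto simp: B_def ne)
    have xB: "x \<in> B" "?y \<in> B" using seg[of 0] seg[of "t n"] t(2)[of n] by auto
    have H0: "H \<ge> 0" using H[OF xB(1)] norm_ge_zero order_trans by blast
    have P0: "P \<ge> 0" using P[OF xB(1)] norm_ge_zero order_trans by blast
    have xm: "\<bar>x $ m\<bar> \<le> \<bar>R + 1\<bar>" using component_le_norm_cart[of x m] True by auto
    have "quadric a b ?y - quadric a b x = (\<Sum>k\<in>UNIV. a $ k * ((?y $ k)\<^sup>2 - (x $ k)\<^sup>2))"
      by (simp add: quadric_def sum_subtractf right_diff_distrib)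
    also have "\<dots> = (\<Sum>k\<in>UNIV. if k = m then a $ k * (2 * x $ k + t n) * t n else 0)"
      by (rule sum.cong) (auto simp: e_def axis_def power2_eq_square algebra_simps)
    finally have "\<bar>quadric a b ?y - quadric a b x\<bar> = a $ m * \<bar>2 * x $ m + t n\<bar> * t n"
      using a[of m] t(2)[of n] by (simp add: abs_mult)
    moreover have "\<bar>2 * x $ m + t n\<bar> \<le> 2 * \<bar>R + 1\<bar> + 1"
      using t(2,3)[of n] xm abs_triangle_ineq[of "2 * x $ m" "t n"] by (simp add: abs_mult)
    then have "a $ m * \<bar>2 * x $ m + t n\<bar> * t n \<le> a $ m * (2 * \<bar>R + 1\<bar> + 1) * t n"
      using a[of m] t(2)[of n] by (intro mult_right_mono mult_left_mono) auto
    moreover have "\<bar>min u 0 - min v 0\<bar> \<le> \<bar>u - v\<bar>" for u v :: real by (auto simp: min_def)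
    ultimately have q: "\<bar>min (quadric a b ?y) 0 - min (quadric a b x) 0\<bar> \<le> a $ m * (2 * \<bar>R + 1\<bar> + 1) * t n"
      using order_trans by metis
    have hd: "cmod (h ?y - h x) \<le> H' * t n"
      unfolding e_def using t(2)[of n] H' seg
      by (intro has_partials_line_bound[OF h]) (auto simp: e_def)
    have "G ?y - G x = of_real (min (quadric a b ?y) 0 - min (quadric a b x) 0) * h ?y
        + of_real (min (quadric a b x) 0) * (h ?y - h x)"
      by (simp add: G_def algebra_simps)
    then have "cmod (G ?y - G x) \<le> cmod (of_real (min (quadric a b ?y) 0 - min (quadric a b x) 0) * h ?y)
        + cmod (of_real (min (quadric a b x) 0) * (h ?y - h x))"
      by (metis norm_triangle_ineq)
    also have "\<dots> \<le> (a $ m * (2 * \<bar>R + 1\<bar> + 1) * t n) * H + P * (H' * t n)"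
    proof (intro add_mono)
      show "cmod (of_real (min (quadric a b ?y) 0 - min (quadric a b x) 0) * h ?y)
          \<le> (a $ m * (2 * \<bar>R + 1\<bar> + 1) * t n) * H"
        unfolding norm_mult norm_of_real
        using q H[OF xB(2)] a[of m] t(2)[of n] by (intro mult_mono) auto
      have "\<bar>min (quadric a b x) 0\<bar> \<le> P" using P[OF xB(1)] P0 by (auto simp: min_def)
      then show "cmod (of_real (min (quadric a b x) 0) * (h ?y - h x)) \<le> P * (H' * t n)"
        unfolding norm_mult norm_of_real using hd P0 by (intro mult_mono) auto
    qed
    also have "\<dots> = K * t n" by (simp add: K_def algebra_simps)
    finally show ?thesis using True t(2)[of n] by (simp add: D_def norm_divide field_simps)
  qed

  \<comment> \<open>Away from the zero set the minimum is locally either the quadric or zero, so the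
    quotient converges there; the kink sits on a null set.\<close>
  have lim: "(\<lambda>n. D n x) \<longlonglongrightarrow> indicator Q x *\<^sub>R F' m x" if x: "quadric a b x \<noteq> 0" for x
  proof -
    have "isCont (quadric a b) x"
      using continuous_on_quadric[of UNIV a b] by (simp add: continuous_on_eq_continuous_at)
    moreover have "(\<lambda>n. x + t n *\<^sub>R e) \<longlonglongrightarrow> x + 0 *\<^sub>R e"
      by (intro tendsto_intros t(1))
    ultimately have qc: "(\<lambda>n. quadric a b (x + t n *\<^sub>R e)) \<longlonglongrightarrow> quadric a b x"
      using isCont_tendsto_compose[of x "quadric a b"] by simp
    show ?thesis
    proof (cases "quadric a b x < 0")
      case True
      have "(\<lambda>n. (of_real (quadric a b (x + t n *\<^sub>R e)) * h (x + t n *\<^sub>R e) - of_real (quadric a b x) * h x)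
          / of_real (t n)) \<longlonglongrightarrow> F' m x"
        unfolding e_def by (rule has_partials_quotient_tendsto[OF F t(1,2)])
      moreover have "\<forall>\<^sub>F n in sequentially.
          (of_real (quadric a b (x + t n *\<^sub>R e)) * h (x + t n *\<^sub>R e) - of_real (quadric a b x) * h x)
          / of_real (t n) = D n x"
        using order_tendstoD(2)[OF qc True]
        by eventually_elim (use True in \<open>simp add: D_def G_def min_absorb1\<close>)
      ultimately have "(\<lambda>n. D n x) \<longlonglongrightarrow> F' m x" by (rule Lim_transform_eventually)
      then show ?thesis using True by (simp add: Q(4))
    next
      case False
      then have pos: "quadric a b x > 0" using x by simp
      have "\<forall>\<^sub>F n in sequentially. D n x = 0"
        using order_tendstoD(1)[OF qc pos]
        by eventually_elim (use pos in \<open>simp add: D_def G_def min_absorb2\<close>)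
      then show ?thesis using pos by (simp add: Q(4) tendsto_eventually)
    qed
  qed

  have [measurable]: "G \<in> borel_measurable borel" "F' m \<in> borel_measurable borel"
    using Gc F'c by (auto intro: borel_measurable_continuous_onI)
  have "(\<lambda>n. \<integral>x. D n x \<partial>lborel) \<longlonglongrightarrow> (\<integral>x. indicator Q x *\<^sub>R F' m x \<partial>lborel)"
  proof (rule integral_dominated_convergence[where w = "\<lambda>x. indicator (cball 0 (R + 1)) x * K"])
    have "{x. quadric a b x = 0} \<in> sets borel"
      by (intro borel_closed closed_Collect_eq continuous_on_quadric continuous_on_const)
    then have "{x. quadric a b x = 0} \<in> null_sets lborel"
      using negligible_quadric_eq_0[OF a, of b]
      by (simp add: negligible_iff_null_sets null_sets_completion_iff)
    from AE_not_in[OF this] show "AE x in lborel. (\<lambda>n. D n x) \<longlonglongrightarrow> indicator Q x *\<^sub>R F' m x"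
      by eventually_elim (use lim in simp)
    show "integrable lborel (\<lambda>x :: real ^ 'd. indicator (cball 0 (R + 1)) x * K)"
      by (intro integrable_mult_left integrable_real_indicator) (use emeasure_bounded_finite[of "cball 0 (R + 1) :: (real ^ 'd) set"] in \<open>auto simp: less_top\<close>)
    show "(\<lambda>x. indicator Q x *\<^sub>R F' m x) \<in> borel_measurable lborel" using Q(3) by measurable
    show "D n \<in> borel_measurable lborel" for n unfolding D_def by measurable
  qed (use Dbound in auto)
  then have "(\<integral>x. indicator Q x *\<^sub>R F' m x \<partial>lborel) = 0"
    unfolding D0 using LIMSEQ_unique tendsto_const by blast
  then show ?thesis
    using integral_lebesgue_on_eq_lborel[OF Q(3) \<open>F' m \<in> borel_measurable borel\<close>]
    unfolding F'_def Q_def by simp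
qed

section \<open>The self-adjoint realization\<close>

definition degenerate_laplacian ::
    "real ^ 'd \<Rightarrow> real ^ 'd \<Rightarrow> real \<Rightarrow> (real ^ 'd \<Rightarrow> complex) \<Rightarrow> real ^ 'd \<Rightarrow> complex" where
  "degenerate_laplacian \<alpha> a b f x =
     (\<Sum>m\<in>UNIV. of_real (\<alpha> $ m) * (of_real (2 * a $ m * x $ m) * partial_deriv m f x
        + of_real (quadric a b x) * partial_deriv m (partial_deriv m f) x))"

lemma diag_mult_vec_nth:
  fixes v :: "'a::semiring_1 ^ 'd"
  shows "(diag v *v x) $ m = v $ m * x $ m"
proof -
  have "(diag v *v x) $ m = (\<Sum>j\<in>UNIV. if m = j then v $ m * x $ j else 0)"
    unfolding diag_def matrix_vector_mult_def vec_lambda_beta by (rule sum.cong) auto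
  then show ?thesis by simp
qed

lemma diag_quadratic_form: "x \<bullet> (diag a *v x) = (\<Sum>n\<in>UNIV. a $ n * (x $ n)\<^sup>2)"
  by (simp add: inner_vec_def diag_mult_vec_nth power2_eq_square mult_ac)

lemma map_matrix_diag: "map_matrix of_real (diag v) = diag (\<chi> m. of_real (v $ m))"
  by (simp add: diag_def map_matrix_def vec_eq_iff)

lemma C2_continuous:
  assumes "C2 f"
  shows "continuous_on T f" "continuous_on T (partial_deriv m f)"
    "continuous_on T (partial_deriv n (partial_deriv m f))"
  using has_partials_continuous[OF C2_D(1)[OF assms]] has_partials_continuous[OF C2_D(2)[OF assms]]
    continuous_on_subset[OF C2_D(3)[OF assms]] by auto

lemma transpose_diag: "transpose (diag v) = diag v"
  by (simp add: transpose_def diag_def vec_eq_iff)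

lemma divergence_form_eq:
  assumes A: "\<And>x. A x = diag (\<chi> m. \<alpha> $ m * quadric a b x)" and f: "C2 f"
  shows "divergence_form A C f = (\<lambda>x. degenerate_laplacian \<alpha> a b f x + of_real (C x) * f x)"
proof
  fix x
  have comp: "(map_matrix of_real (A y) *v gradient f y) $ m
      = of_real (\<alpha> $ m) * (of_real (quadric a b y) * partial_deriv m f y)" for y m
    unfolding A map_matrix_diag diag_mult_vec_nth by (simp add: gradient_def)
  have "has_partials (\<lambda>y. of_real (\<alpha> $ m) * (of_real (quadric a b y) * partial_deriv m f y))
     (\<lambda>n y. of_real (\<alpha> $ m) * (of_real (2 * a $ n * y $ n) * partial_deriv m f y
        + of_real (quadric a b y) * partial_deriv n (partial_deriv m f) y))" for m
    by (intro has_partials_cmult has_partials_mult has_partials_quadric C2_D(2) f)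
  from has_partials_unique[OF this]
  show "divergence_form A C f x = degenerate_laplacian \<alpha> a b f x + of_real (C x) * f x"
    unfolding divergence_form_def divergence_def comp degenerate_laplacian_def by simp
qed

lemma degenerate_laplacian_continuous:
  assumes "C2 f"
  shows "continuous_on S (degenerate_laplacian \<alpha> a b f)"
proof -
  show ?thesis
    unfolding degenerate_laplacian_def by (intro continuous_intros C2_continuous assms)
qed

text \<open>Green's identity: the difference of the two integrands is the divergence of the field
  with components \<open>\<alpha> $ m\<close> times the quadric times \<open>h m\<close>, where
  \<open>h m\<close> is the Wronskian of \<open>f\<close> and \<open>cnj g\<close> in direction
  \<open>m\<close>. The quadric kills the boundary term.\<close>

lemma degenerate_laplacian_symmetric:
  fixes a :: "real ^ 'd" and b :: real
  assumes a: "\<And>m. a $ m > 0" and f: "C2 f" and g: "C2 g"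
  defines "S \<equiv> quadratic_domain 0 a b"
  shows "L2_inner S (degenerate_laplacian \<alpha> a b f) g = L2_inner S f (degenerate_laplacian \<alpha> a b g)"
proof -
  have S: "compact S" unfolding S_def using a by (rule compact_quadratic_domain)
  let ?L = "degenerate_laplacian \<alpha> a b"
  let ?d = "partial_deriv"
  define h where "h = (\<lambda>m x. ?d m f x * cnj (g x) + (-1) * (f x * cnj (?d m g x)))"
  define h' where "h' = (\<lambda>m n x. (?d n (?d m f) x * cnj (g x) + ?d m f x * cnj (?d n g x))
      + (-1) * (?d n f x * cnj (?d m g x) + f x * cnj (?d n (?d m g) x)))"
  have h: "has_partials (h m) (h' m)" for m
    unfolding h_def h'_def
    by (intro has_partials_add has_partials_mult has_partials_cmult has_partials_cnj C2_D f g)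
  note fc = C2_continuous[OF f] C2_continuous[OF g]
  have h'c: "continuous_on T (h' m n)" for m n T
    unfolding h'_def by (intro continuous_intros fc)
  have hc: "continuous_on T (h m)" for m T using h by (rule has_partials_continuous)
  have L: "f \<in> L2 S" "g \<in> L2 S" "?L f \<in> L2 S" "?L g \<in> L2 S"
    using S fc degenerate_laplacian_continuous[OF f] degenerate_laplacian_continuous[OF g]
    by (auto intro: L2_continuous)
  have int: "integrable (lebesgue_on S) w" if "continuous_on S w" for w :: "real ^ 'd \<Rightarrow> complex"
    using
      L2_inner_integrable[OF L2_continuous[OF S that] L2_continuous[OF S continuous_on_const[of S 1]]]
    by simp
  have "L2_inner S (?L f) g - L2_inner S f (?L g)
      = (\<integral>x. ?L f x * cnj (g x) - f x * cnj (?L g x) \<partial>lebesgue_on S)"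
    unfolding L2_inner_def using L L2_inner_integrable by (intro Bochner_Integration.integral_diff[symmetric]) auto
  also have "\<dots> = (\<integral>x. (\<Sum>m\<in>UNIV. of_real (\<alpha> $ m) * (of_real (2 * a $ m * x $ m) * h m x
        + of_real (quadric a b x) * h' m m x)) \<partial>lebesgue_on S)"
    unfolding degenerate_laplacian_def h_def h'_def
    by (intro Bochner_Integration.integral_cong refl)
      (simp add: sum_distrib_left sum_distrib_right flip: sum_subtractf, auto intro!: sum.cong simp: algebra_simps)
  also have "\<dots> = (\<Sum>m\<in>UNIV. \<integral>x. of_real (\<alpha> $ m) * (of_real (2 * a $ m * x $ m) * h m x
        + of_real (quadric a b x) * h' m m x) \<partial>lebesgue_on S)"
    by (intro Bochner_Integration.integral_sum int continuous_intros hc h'c)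
  also have "\<dots> = (\<Sum>m\<in>(UNIV::'d set). of_real (\<alpha> $ m) * 0)"
    using integral_partial_quadric[OF a h h'c] by (simp add: S_def)
  finally show ?thesis by simp
qed

text \<open>Every derivative lowers the degree by one and is compensated by at most one coordinate
  factor: one for the first-order terms, two for the quadric before second derivatives.\<close>

lemma degenerate_laplacian_poly_lt:
  assumes p: "poly_lt n p"
  shows "poly_lt n (degenerate_laplacian \<alpha> a b p)"
proof -
  have d1: "poly_lt (n - 1) (partial_deriv m p)" for m using p by (rule poly_lt_partial_deriv)
  have d2: "poly_lt (n - 1 - 1) (partial_deriv m (partial_deriv m p))" for m
    using d1 by (rule poly_lt_partial_deriv)
  have q: "poly_lt n (\<lambda>x. of_real (quadric a b x) * partial_deriv m (partial_deriv m p) x)" for m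
  proof -
    have "poly_lt n (\<lambda>x. (\<Sum>k\<in>UNIV. of_real (a $ k) *
        (of_real (x $ k) * (of_real (x $ k) * partial_deriv m (partial_deriv m p) x)))
        + of_real (- b) * partial_deriv m (partial_deriv m p) x)"
      by (intro poly_lt_add poly_lt_sum poly_lt_cmult poly_lt_coord_pred d2 finite_class.finite_UNIV)
        (rule poly_lt_mono[OF _ d2], simp)
    then show ?thesis
      by (simp add: quadric_def algebra_simps sum_distrib_left power2_eq_square)
  qed
  have "poly_lt n (\<lambda>x. \<Sum>m\<in>UNIV. of_real (\<alpha> $ m) * (of_real (2 * a $ m) * (of_real (x $ m) * partial_deriv m p x)
        + of_real (quadric a b x) * partial_deriv m (partial_deriv m p) x))"
    by (intro poly_lt_sum poly_lt_cmult poly_lt_add poly_lt_coord_pred d1 q finite_class.finite_UNIV)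
  then show ?thesis unfolding degenerate_laplacian_def by (simp add: mult.assoc)
qed

text \<open>An adjoint rather than a closure: to show that a pair belongs to it, only inner products
  with polynomials have to be compared, and no approximating sequence has to be produced.\<close>

definition realization ::
    "real ^ 'd \<Rightarrow> real ^ 'd \<Rightarrow> real \<Rightarrow> (real ^ 'd \<Rightarrow> real) \<Rightarrow> (real ^ 'd) graph" where
  "realization \<alpha> a b C = adjoint_graph (quadratic_domain 0 a b)
     {(u, \<lambda>x. degenerate_laplacian \<alpha> a b u x + of_real (C x) * u x) | u. u \<in> (\<Union>n. Collect (poly_lt n))}"

context
  fixes a \<alpha> :: "real ^ 'd" and b :: real and C :: "real ^ 'd \<Rightarrow> real" and S
  assumes a: "\<And>m. a $ m > 0" and C: "continuous_on UNIV C"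
  defines "S \<equiv> quadratic_domain 0 a b"
begin

lemma realization_compact: "compact S"
  unfolding S_def using a by (rule compact_quadratic_domain)

lemma realization_mult_L2: "f \<in> L2 S \<Longrightarrow> (\<lambda>x. of_real (C x) * f x) \<in> L2 S"
proof -
  assume f: "f \<in> L2 S"
  have c: "continuous_on S (\<lambda>x. complex_of_real (C x))"
    using C by (intro continuous_intros) (rule continuous_on_subset, auto)
  obtain B where "\<And>x. x \<in> S \<Longrightarrow> cmod (of_real (C x)) \<le> B"
    using compact_imp_bounded[OF compact_continuous_image[OF c realization_compact]]
    by (auto simp: bounded_iff)
  then show ?thesis
    using lmeasurable_compact[OF realization_compact] c f
    by (intro L2_mult_bounded borel_measurable_continuous_lebesgue_on) auto
qed

lemma realization_generator_symmetric:
  assumes "C2 f" "C2 g"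
  shows "L2_inner S (\<lambda>x. degenerate_laplacian \<alpha> a b f x + of_real (C x) * f x) g
    = L2_inner S f (\<lambda>x. degenerate_laplacian \<alpha> a b g x + of_real (C x) * g x)"
proof -
  have L: "f \<in> L2 S" "g \<in> L2 S" "degenerate_laplacian \<alpha> a b f \<in> L2 S" "degenerate_laplacian \<alpha> a b g \<in> L2 S"
    using realization_compact C2_continuous(1) degenerate_laplacian_continuous assms
    by (auto intro!: L2_continuous)
  note M = realization_mult_L2[OF L(1)] realization_mult_L2[OF L(2)]
  have "L2_inner S (\<lambda>x. of_real (C x) * f x) g = L2_inner S f (\<lambda>x. of_real (C x) * g x)"
    unfolding L2_inner_def by (simp add: ac_simps)
  then show ?thesis
    using degenerate_laplacian_symmetric[OF a assms, of b \<alpha>, folded S_def]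
      L2_inner_add(1)[OF L(3) M(1) L(2)] L2_inner_add(2)[OF L(4) M(2) L(1)] by simp
qed

text \<open>Symmetry between a C2 function and all polynomials is precisely membership in the
  adjoint.\<close>

lemma realization_C2:
  assumes f: "C2 f"
  shows "(f, \<lambda>x. degenerate_laplacian \<alpha> a b f x + of_real (C x) * f x) \<in> realization \<alpha> a b C"
proof -
  have L: "f \<in> L2 S" "degenerate_laplacian \<alpha> a b f \<in> L2 S"
    using realization_compact C2_continuous(1) degenerate_laplacian_continuous f
    by (auto intro!: L2_continuous)
  then show ?thesis
    unfolding realization_def adjoint_graph_def S_def[symmetric]
    using realization_generator_symmetric[OF poly_lt_C2 f] realization_mult_L2
    by (auto intro!: L2_add)
qed

lemma poly_lt_L2: "poly_lt n p \<Longrightarrow> p \<in> L2 S"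
  using realization_compact poly_lt_continuous by (rule L2_continuous)

lemma realization_symmetric: "symmetric_graph S (realization \<alpha> a b C)"
  unfolding realization_def S_def[symmetric]
proof (rule adjoint_graph_bounded_perturbation)
  let ?V = "\<lambda>n. Collect (poly_lt n) :: (real ^ 'd \<Rightarrow> complex) set"
  show "symmetric_graph S (adjoint_graph S {(u, degenerate_laplacian \<alpha> a b u) | u. u \<in> (\<Union>n. ?V n)})"
  proof (rule adjoint_graph_of_invariant_finite_dimensional)
    show "?V n \<subseteq> ?V (Suc n)" for n by (auto intro: poly_lt_Suc)
    show "\<exists>B. finite B \<and> B \<subseteq> ?V n \<and> (\<forall>v\<in>?V n. \<exists>c. v = (\<lambda>x. \<Sum>b\<in>B. c b * b x))" for n
    proof -
      obtain B where B: "finite B" "B \<subseteq> ?V n" "\<forall>p. poly_lt n p \<longrightarrow> lin_span B p"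
        using poly_lt_finite_basis by blast
      then have "\<forall>v\<in>?V n. \<exists>c. v = (\<lambda>x. \<Sum>b\<in>B. c b * b x)" using lin_span_finite by blast
      then show ?thesis using B(1,2) by blast
    qed
    show "\<exists>u\<in>\<Union>n. ?V n. L2_norm S (\<lambda>x. f x - u x) < e" if "f \<in> L2 S" "e > 0" for f e
      using L2_dense_poly[OF realization_compact that] by blast
    show "L2_inner S (degenerate_laplacian \<alpha> a b u) v = L2_inner S u (degenerate_laplacian \<alpha> a b v)"
      if "u \<in> (\<Union>n. ?V n)" "v \<in> (\<Union>n. ?V n)" for u v
      using that degenerate_laplacian_symmetric[OF a poly_lt_C2 poly_lt_C2] unfolding S_def by blast
  qed (auto intro: poly_lt_L2 poly_lt_zero poly_lt_add poly_lt_cmult degenerate_laplacian_poly_lt)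
qed (auto intro: poly_lt_L2 degenerate_laplacian_poly_lt realization_mult_L2)

lemma realization_self_adjoint: "self_adjoint S (realization \<alpha> a b C)"
  unfolding realization_def S_def[symmetric]
proof (rule self_adjoint_adjoint_graph)
  let ?D = "{(u, \<lambda>x. degenerate_laplacian \<alpha> a b u x + of_real (C x) * u x) | u.
      u \<in> (\<Union>n. Collect (poly_lt n))}"
  show "?D \<subseteq> L2 S \<times> L2 S"
    by (auto intro!: L2_add realization_mult_L2 intro: poly_lt_L2 degenerate_laplacian_poly_lt)
  show "densely_defined S ?D"
    unfolding densely_defined_def
  proof (intro ballI allI impI)
    fix f and e :: real assume "f \<in> L2 S" "e > 0"
    from L2_dense_poly[OF realization_compact this]
    obtain n p where p: "poly_lt n p" "L2_norm S (\<lambda>x. f x - p x) < e" by blast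
    then have "p \<in> Domain ?D" by blast
    then show "\<exists>u\<in>Domain ?D. L2_norm S (\<lambda>x. f x - u x) < e" using p(2) by blast
  qed
  show "symmetric_graph S ?D"
    unfolding symmetric_graph_def using realization_generator_symmetric[OF poly_lt_C2 poly_lt_C2] by blast
  show "symmetric_graph S (adjoint_graph S ?D)"
    using realization_symmetric unfolding realization_def S_def[symmetric] .
qed

end

section \<open>Superpositions of elements of an adjoint graph\<close>

text \<open>Once the identity of a product is measurable into \<open>borel\<close>, every continuous
  function is measurable for the product of restricted Lebesgue measures, which is not itself a
  \<open>lebesgue_on\<close> measure.\<close>

lemma borel_measurable_ident_pair:
  fixes M :: "'a::second_countable_topology measure" and N :: "'b::second_countable_topology measure"
  assumes "(\<lambda>x. x) \<in> M \<rightarrow>\<^sub>M borel" "(\<lambda>y. y) \<in> N \<rightarrow>\<^sub>M borel"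
  shows "(\<lambda>p. p) \<in> M \<Otimes>\<^sub>M N \<rightarrow>\<^sub>M borel"
proof -
  have "(\<lambda>p. (fst p, snd p)) \<in> M \<Otimes>\<^sub>M N \<rightarrow>\<^sub>M borel \<Otimes>\<^sub>M borel"
    using measurable_compose[OF measurable_fst assms(1)] measurable_compose[OF measurable_snd assms(2)]
    by (rule measurable_Pair)
  then show ?thesis by (simp add: borel_prod)
qed

lemma borel_measurable_ident_lebesgue_on:
  fixes S :: "'a::euclidean_space set"
  shows "(\<lambda>x. x) \<in> lebesgue_on S \<rightarrow>\<^sub>M borel"
  by (intro measurable_restrict_space1 measurable_completion) simp

lemma borel_measurable_continuous_ident:
  assumes "(\<lambda>x. x) \<in> M \<rightarrow>\<^sub>M borel" "continuous_on UNIV f"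
  shows "f \<in> M \<rightarrow>\<^sub>M borel"
  using measurable_compose[OF assms(1) borel_measurable_continuous_onI[OF assms(2)]] by simp

lemma norm_integral_le_integral:
  fixes f :: "'b \<Rightarrow> complex"
  assumes f: "integrable M f" and g: "integrable M g" and le: "\<And>t. t \<in> space M \<Longrightarrow> norm (f t) \<le> g t"
  shows "norm (\<integral>t. f t \<partial>M) \<le> (\<integral>t. g t \<partial>M)"
proof -
  have "norm (\<integral>t. f t \<partial>M) \<le> (\<integral>t. norm (f t) \<partial>M)" by (rule integral_norm_bound)
  also have "\<dots> \<le> (\<integral>t. g t \<partial>M)"
    using f g le by (intro Bochner_Integration.integral_mono) auto
  finally show ?thesis .
qed

lemma L2_integrable:
  assumes "S \<in> lmeasurable" "f \<in> L2 S"
  shows "integrable (lebesgue_on S) f"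
proof -
  have "(\<lambda>x. 1) \<in> L2 S" using assms(1) by (intro L2_bounded[where B = 1]) auto
  from L2_inner_integrable[OF assms(2) this] show ?thesis by simp
qed

text \<open>Against a fixed pair of \<open>D\<close>, membership is a conjugate-linear condition,
  and Fubini moves the integral over \<open>t\<close> out of the inner product. The weight is merely
  integrable and the family bounded, so that \<open>w\<close> can be an element of L2 on a set of
  finite measure.\<close>

lemma adjoint_graph_superposition:
  fixes M :: "'b measure" and S :: "'a::euclidean_space set"
  assumes D: "D \<subseteq> L2 S \<times> L2 S" and S: "S \<in> lmeasurable" and M: "finite_measure M"
    and T: "\<And>t. t \<in> space M \<Longrightarrow> (\<psi> t, \<eta> t) \<in> adjoint_graph S D"
    and w: "integrable M w"
    and \<psi>: "(\<lambda>(x, t). \<psi> t x) \<in> borel_measurable (lebesgue_on S \<Otimes>\<^sub>M M)"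
    and \<eta>: "(\<lambda>(x, t). \<eta> t x) \<in> borel_measurable (lebesgue_on S \<Otimes>\<^sub>M M)"
    and \<psi>B: "\<And>t x. t \<in> space M \<Longrightarrow> x \<in> S \<Longrightarrow> cmod (\<psi> t x) \<le> B"
    and \<eta>B: "\<And>t x. t \<in> space M \<Longrightarrow> x \<in> S \<Longrightarrow> cmod (\<eta> t x) \<le> B"
  shows "(\<lambda>x. \<integral>t. w t * \<psi> t x \<partial>M, \<lambda>x. \<integral>t. w t * \<eta> t x \<partial>M) \<in> adjoint_graph S D"
proof -
  interpret M: finite_measure M by (rule M)
  interpret S: finite_measure "lebesgue_on S" using S by (rule finite_measure_lebesgue_on)
  interpret SM: pair_sigma_finite "lebesgue_on S" M ..
  have wm [measurable]: "w \<in> borel_measurable M" using w by (rule borel_measurable_integrable)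
  have member: "(\<lambda>x. \<integral>t. w t * \<phi> t x \<partial>M) \<in> L2 S"
    and swap: "u \<in> L2 S \<Longrightarrow> L2_inner S u (\<lambda>x. \<integral>t. w t * \<phi> t x \<partial>M) = (\<integral>t. cnj (w t) * L2_inner S u (\<phi> t) \<partial>M)"
    if \<phi>: "(\<lambda>(x, t). \<phi> t x) \<in> borel_measurable (lebesgue_on S \<Otimes>\<^sub>M M)"
      and \<phi>B: "\<And>t x. t \<in> space M \<Longrightarrow> x \<in> S \<Longrightarrow> cmod (\<phi> t x) \<le> B" for \<phi> u
  proof -
    note [measurable] = \<phi>
    have le: "cmod (w t * \<phi> t x) \<le> B * cmod (w t)" if "t \<in> space M" "x \<in> S" for t x
      unfolding norm_mult mult.commute[of B] using \<phi>B[OF that] by (rule mult_left_mono) simp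
    have le_abs: "cmod (w t * \<phi> t x) \<le> \<bar>B * cmod (w t)\<bar>" if "t \<in> space M" "x \<in> S" for t x
      using le[OF that] by linarith
    show "(\<lambda>x. \<integral>t. w t * \<phi> t x \<partial>M) \<in> L2 S"
    proof (rule L2_bounded[OF S])
      show "(\<lambda>x. \<integral>t. w t * \<phi> t x \<partial>M) \<in> borel_measurable (lebesgue_on S)"
        by (rule M.borel_measurable_lebesgue_integral) measurable
      show "cmod (\<integral>t. w t * \<phi> t x \<partial>M) \<le> (\<integral>t. B * cmod (w t) \<partial>M)" if "x \<in> S" for x
      proof (rule norm_integral_le_integral)
        show "integrable M (\<lambda>t. w t * \<phi> t x)"
        proof (rule Bochner_Integration.integrable_bound)
          show "integrable M (\<lambda>t. B * cmod (w t))" using w by simp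
          have "(\<lambda>t. (x, t)) \<in> M \<rightarrow>\<^sub>M lebesgue_on S \<Otimes>\<^sub>M M" using that by (intro measurable_Pair1') simp
          from measurable_compose[OF this \<phi>] have [measurable]: "(\<lambda>t. \<phi> t x) \<in> borel_measurable M" by simp
          show "(\<lambda>t. w t * \<phi> t x) \<in> borel_measurable M" by measurable
          show "AE t in M. norm (w t * \<phi> t x) \<le> norm (B * cmod (w t))"
            using le_abs[OF _ that] by (intro AE_I2) simp
        qed
        show "integrable M (\<lambda>t. B * cmod (w t))" using w by simp
        show "norm (w t * \<phi> t x) \<le> B * cmod (w t)" if "t \<in> space M" for t
          using le[OF that \<open>x \<in> S\<close>] .
      qed
    qed
    assume u: "u \<in> L2 S"
    note [measurable] = L2_D(1)[OF u]
    have ui: "integrable (lebesgue_on S) u" using S u by (rule L2_integrable)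
    have int: "integrable (lebesgue_on S \<Otimes>\<^sub>M M) (\<lambda>(x, t). u x * cnj (w t * \<phi> t x))"
    proof (rule Bochner_Integration.integrable_bound)
      \<comment> \<open>A product majorant: \<open>u\<close> is integrable since \<open>S\<close>
        has finite measure, and \<open>w\<close> by hypothesis.\<close>
      show "integrable (lebesgue_on S \<Otimes>\<^sub>M M) (\<lambda>(x, t). cmod (u x) * (B * cmod (w t)))"
      proof (rule SM.Fubini_integrable)
        show "integrable (lebesgue_on S) (\<lambda>x. \<integral>t. norm (case (x, t) of (x, t) \<Rightarrow> cmod (u x) * (B * cmod (w t))) \<partial>M)"
          using ui by (simp add: abs_mult)
        show "AE x in lebesgue_on S. integrable M (\<lambda>t. case (x, t) of (x, t) \<Rightarrow> cmod (u x) * (B * cmod (w t)))"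
          using w by simp
      qed measurable
      show "AE p in lebesgue_on S \<Otimes>\<^sub>M M. norm (case p of (x, t) \<Rightarrow> u x * cnj (w t * \<phi> t x))
          \<le> norm (case p of (x, t) \<Rightarrow> cmod (u x) * (B * cmod (w t)))"
      proof (rule AE_I2, clarsimp simp: space_pair_measure norm_mult[of "u _"] abs_mult[of "cmod (u _)"])
        fix x t assume "x \<in> S" "t \<in> space M"
        then show "cmod (u x) * cmod (cnj (w t) * cnj (\<phi> t x)) \<le> cmod (u x) * \<bar>B * cmod (w t)\<bar>"
          using le_abs by (intro mult_left_mono) (simp_all flip: complex_cnj_mult)
      qed
    qed measurable
    have "L2_inner S u (\<lambda>x. \<integral>t. w t * \<phi> t x \<partial>M)
        = (\<integral>x. \<integral>t. u x * cnj (w t * \<phi> t x) \<partial>M \<partial>lebesgue_on S)"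
      unfolding L2_inner_def by (simp del: complex_cnj_mult flip: Bochner_Integration.integral_cnj)
    also have "\<dots> = (\<integral>t. \<integral>x. u x * cnj (w t * \<phi> t x) \<partial>lebesgue_on S \<partial>M)"
      using SM.Fubini_integral[OF int] by simp
    also have "\<dots> = (\<integral>t. cnj (w t) * L2_inner S u (\<phi> t) \<partial>M)"
      unfolding L2_inner_def by (simp add: mult.left_commute[of "u _"])
    finally show "L2_inner S u (\<lambda>x. \<integral>t. w t * \<phi> t x \<partial>M) = (\<integral>t. cnj (w t) * L2_inner S u (\<phi> t) \<partial>M)" .
  qed
  have "L2_inner S v (\<lambda>x. \<integral>t. w t * \<psi> t x \<partial>M) = L2_inner S u (\<lambda>x. \<integral>t. w t * \<eta> t x \<partial>M)"
    if uv: "(u, v) \<in> D" for u v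
  proof -
    have "L2_inner S v (\<psi> t) = L2_inner S u (\<eta> t)" if "t \<in> space M" for t
      using adjoint_graph_D(3)[OF T[OF that] uv] .
    then have "(\<integral>t. cnj (w t) * L2_inner S v (\<psi> t) \<partial>M) = (\<integral>t. cnj (w t) * L2_inner S u (\<eta> t) \<partial>M)"
      by (intro Bochner_Integration.integral_cong) auto
    then show ?thesis using swap[OF \<psi> \<psi>B, of v] swap[OF \<eta> \<eta>B, of u] uv D by auto
  qed
  then show ?thesis
    unfolding adjoint_graph_def using member[OF \<psi> \<psi>B] member[OF \<eta> \<eta>B] by auto
qed

section \<open>Quadratic domains of finite measure\<close>

lemma quadratic_domain_lmeasurable:
  assumes "indicator (quadratic_domain 0 a b) \<in> L2 UNIV"
  shows "quadratic_domain 0 a b \<in> lmeasurable"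
proof -
  let ?Q = "quadratic_domain 0 a b"
  have "(\<lambda>x. (cmod (indicator ?Q x))\<^sup>2) = (indicator ?Q :: _ \<Rightarrow> real)"
    by (auto simp: indicator_def)
  then have "integrable lebesgue (indicator ?Q :: _ \<Rightarrow> real)"
    using L2_D(2)[OF assms] by (simp add: lebesgue_on_UNIV_eq)
  moreover have "?Q \<in> sets lebesgue" by (intro sets_completionI_sets) (simp add: borel_closed closed_quadratic_domain)
  ultimately show ?thesis by (simp add: integrable_indicator_iff fmeasurable_def)
qed

text \<open>If \<open>a $ m \<le> 0\<close>, the domain contains its image under doubling the \<open>m\<close>-th coordinate, which has
  twice its measure.\<close>

lemma quadratic_domain_negligible_or_pos:
  fixes a :: "real ^ 'd"
  assumes Q: "quadratic_domain 0 a b \<in> lmeasurable"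
  shows "negligible (quadratic_domain 0 a b) \<or> (\<forall>m. a $ m > 0)"
proof (rule disjCI)
  assume "\<not> (\<forall>m. a $ m > 0)"
  then obtain m where m: "a $ m \<le> 0" by (auto simp: not_less)
  let ?Q = "quadratic_domain 0 a b"
  define c :: "'d \<Rightarrow> real" where "c = (\<lambda>k. if k = m then 2 else 1)"
  define f :: "real ^ 'd \<Rightarrow> real ^ 'd" where "f = (\<lambda>x. \<chi> k. c k * x $ k)"
  have "f ` ?Q \<subseteq> ?Q"
  proof
    fix y assume "y \<in> f ` ?Q"
    then obtain x where x: "x \<in> ?Q" "y = f x" by blast
    have "(\<Sum>k\<in>UNIV. a $ k * (y $ k)\<^sup>2) \<le> (\<Sum>k\<in>UNIV. a $ k * (x $ k)\<^sup>2)"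
    proof (rule sum_mono)
      fix k
      show "a $ k * (y $ k)\<^sup>2 \<le> a $ k * (x $ k)\<^sup>2"
        using m by (auto simp: x(2) f_def c_def power_mult_distrib mult_le_0_iff)
    qed
    then show "y \<in> ?Q" using x(1) by (auto simp: quadratic_domain_0 quadric_def)
  qed
  then have "measure lebesgue (f ` ?Q) \<le> measure lebesgue ?Q"
    using Q measurable_stretch[OF Q, of c] unfolding f_def by (intro measure_mono_fmeasurable) auto
  moreover have "measure lebesgue (f ` ?Q) = \<bar>prod c UNIV\<bar> * measure lebesgue ?Q"
    unfolding f_def using Q by (rule measure_stretch)
  moreover have "prod c UNIV = 2" by (simp add: c_def)
  ultimately have "measure lebesgue ?Q \<le> 0" by simp
  then have "measure lebesgue ?Q = 0" using measure_nonneg antisym by blast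
  then show "negligible ?Q" using Q by (simp add: negligible_iff_measure)
qed

section \<open>Functions on null sets\<close>

lemma integral_lebesgue_on_negligible:
  fixes f :: "'a::euclidean_space \<Rightarrow> complex"
  assumes "negligible S"
  shows "(\<integral>x. f x \<partial>lebesgue_on S) = 0"
proof (rule integral_eq_zero_AE)
  have "S \<in> sets lebesgue" using assms negligible_imp_sets by blast
  moreover have "AE x in lebesgue. x \<notin> S"
    using assms by (intro AE_not_in) (simp add: negligible_iff_null_sets)
  ultimately show "AE x in lebesgue_on S. f x = 0"
    by (subst AE_restrict_space_iff) auto
qed

lemma L2_negligible:
  assumes "negligible S"
  shows "f \<in> L2 S"
proof -
  have S: "S \<in> sets lebesgue" using assms negligible_imp_sets by blast
  \<comment> \<open>The exceptional set is all of \<open>S\<close>, so zero functions serve as the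
    approximants of any \<open>g\<close>.\<close>
  have on: "g measurable_on S" for g :: "_ \<Rightarrow> complex"
    unfolding measurable_on_def using assms by (intro exI[of _ S] exI[of _ "\<lambda>n x. 0"]) auto
  have m: "g \<in> borel_measurable (lebesgue_on S)" for g :: "_ \<Rightarrow> complex"
    using on[of g] by (simp add: measurable_on_iff_borel_measurable[OF S])
  have ae: "AE x in lebesgue_on S. x \<notin> S"
    using assms S AE_not_in[of S lebesgue]
    by (subst AE_restrict_space_iff) (auto simp: negligible_iff_null_sets)
  have "integrable (lebesgue_on S) (\<lambda>x. 0 :: real)" by simp
  moreover have "AE x in lebesgue_on S. (cmod (f x))\<^sup>2 = 0"
    using ae AE_space by eventually_elim simp
  ultimately have "integrable (lebesgue_on S) (\<lambda>x. (cmod (f x))\<^sup>2)"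
    using m[of f] by (subst integrable_cong_AE[where g = "\<lambda>x. 0"]) auto
  then show ?thesis using m by (simp add: L2_def)
qed

section \<open>Plane waves and commutation\<close>

definition plane_wave :: "real ^ 'd \<Rightarrow> real ^ 'd \<Rightarrow> complex" where
  "plane_wave \<xi> x = exp (\<i> * of_real (\<xi> \<bullet> x))"

lemma plane_wave_norm [simp]: "cmod (plane_wave \<xi> x) = 1"
  by (simp add: plane_wave_def)

lemma cnj_plane_wave: "cnj (plane_wave \<xi> x) = plane_wave \<xi> (- x)"
  by (simp add: plane_wave_def exp_cnj)

lemma plane_wave_diff: "plane_wave \<xi> (x - y) = plane_wave \<xi> x * cnj (plane_wave \<xi> y)"
  unfolding cnj_plane_wave by (simp add: plane_wave_def inner_diff_right algebra_simps flip: exp_add)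

text \<open>Lets the derivative formula in the space variable be reused in the frequency
  variable.\<close>

lemma plane_wave_commute: "plane_wave \<xi> x = plane_wave x \<xi>"
  by (simp add: plane_wave_def inner_commute)

lemma has_partials_plane_wave:
  "has_partials (plane_wave \<xi>) (\<lambda>m x. \<i> * of_real (\<xi> $ m) * plane_wave \<xi> x)"
proof -
  have "has_partials (\<lambda>x. \<i> * (\<Sum>k\<in>UNIV. complex_of_real (\<xi> $ k) * of_real (x $ k)))
      (\<lambda>m x. \<i> * (\<Sum>k\<in>UNIV. of_real (\<xi> $ k) * (if m = k then 1 else 0)))"
    by (intro has_partials_cmult has_partials_sum has_partials_coord) auto
  moreover have "(\<Sum>k\<in>UNIV. of_real (\<xi> $ k) * (if m = k then 1 else 0)) = complex_of_real (\<xi> $ m)" for m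
    by (simp add: if_distrib cong: if_cong)
  ultimately have "has_partials (\<lambda>x. \<i> * of_real (\<xi> \<bullet> x)) (\<lambda>m x. \<i> * of_real (\<xi> $ m))"
    by (simp add: inner_vec_def)
  from has_partials_exp[OF this] show ?thesis unfolding plane_wave_def .
qed

lemma plane_wave_continuous: "continuous_on S (plane_wave \<xi>)"
  using has_partials_plane_wave by (rule has_partials_continuous)

lemma has_partials_plane_wave2:
  "has_partials (\<lambda>x. \<i> * of_real (\<xi> $ m) * plane_wave \<xi> x)
     (\<lambda>n x. \<i> * of_real (\<xi> $ m) * (\<i> * of_real (\<xi> $ n) * plane_wave \<xi> x))"
  by (intro has_partials_cmult has_partials_plane_wave)

lemma C2_plane_wave: "C2 (plane_wave \<xi>)"
  by (rule C2_I[OF has_partials_plane_wave has_partials_plane_wave2])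
    (intro continuous_intros plane_wave_continuous)

definition wave_symbol ::
    "real ^ 'd \<Rightarrow> real \<Rightarrow> real ^ 'd \<Rightarrow> real \<Rightarrow> real ^ 'd \<Rightarrow> real ^ 'd \<Rightarrow> complex" where
  "wave_symbol \<alpha> \<beta> a b \<xi> x =
     (\<Sum>m\<in>UNIV. of_real (\<alpha> $ m) * (of_real (2 * a $ m * x $ m) * (\<i> * of_real (\<xi> $ m))
        - of_real (quadric a b x) * of_real ((\<xi> $ m)\<^sup>2)))
     + of_real (\<beta> * (\<Sum>n\<in>UNIV. a $ n * (x $ n)\<^sup>2))"

lemma degenerate_laplacian_plane_wave:
  "degenerate_laplacian \<alpha> a b (plane_wave \<xi>) x
     + of_real (\<beta> * (\<Sum>n\<in>UNIV. a $ n * (x $ n)\<^sup>2)) * plane_wave \<xi> x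
   = wave_symbol \<alpha> \<beta> a b \<xi> x * plane_wave \<xi> x"
proof -
  note d1 = has_partials_unique[OF has_partials_plane_wave]
    and d2 = has_partials_unique[OF has_partials_plane_wave2]
  have "degenerate_laplacian \<alpha> a b (plane_wave \<xi>) x =
      (\<Sum>m\<in>UNIV. of_real (\<alpha> $ m) * (of_real (2 * a $ m * x $ m) * (\<i> * of_real (\<xi> $ m))
        - of_real (quadric a b x) * of_real ((\<xi> $ m)\<^sup>2))) * plane_wave \<xi> x"
    unfolding degenerate_laplacian_def sum_distrib_right d1 d2
    by (rule sum.cong) (simp_all add: algebra_simps power2_eq_square)
  then show ?thesis unfolding wave_symbol_def by (simp only: distrib_right)
qed

text \<open>After multiplication by \<open>plane_wave \<xi> (x - y)\<close>, each summand on the right becomes a total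
  derivative in \<open>\<xi> $ m\<close> of \<open>quadric \<alpha> \<beta> \<xi> * plane_wave \<xi> (x - y)\<close>.\<close>

lemma wave_symbol_diff:
  "wave_symbol \<alpha> \<beta> a b \<xi> x - cnj (wave_symbol \<alpha> \<beta> a b \<xi> y) =
     (\<Sum>m\<in>UNIV. \<i> * of_real (a $ m * (x $ m + y $ m)) * (of_real (2 * \<alpha> $ m * \<xi> $ m)
        + of_real (quadric \<alpha> \<beta> \<xi>) * (\<i> * of_real ((x - y) $ m))))"
proof -
  define X Y where "X = (\<Sum>n\<in>UNIV. a $ n * (x $ n)\<^sup>2)" and "Y = (\<Sum>n\<in>UNIV. a $ n * (y $ n)\<^sup>2)"
  \<comment> \<open>Written this way, the difference shares the factor
    \<open>a $ m * (x $ m + y $ m)\<close> with the imaginary parts, and everything can be collected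
    coordinate by coordinate.\<close>
  have XY: "X - Y = (\<Sum>m\<in>UNIV. a $ m * (x $ m + y $ m) * ((x - y) $ m))"
    unfolding X_def Y_def by (simp add: power2_eq_square algebra_simps flip: sum_subtractf)
  let ?s = "\<Sum>m\<in>UNIV. \<alpha> $ m * (\<xi> $ m)\<^sup>2"
  have symb: "wave_symbol \<alpha> \<beta> a b \<xi> z = \<i> * of_real (\<Sum>m\<in>UNIV. 2 * \<alpha> $ m * a $ m * z $ m * \<xi> $ m)
      + of_real (\<beta> * Z - (Z - b) * ?s)" if "Z = (\<Sum>n\<in>UNIV. a $ n * (z $ n)\<^sup>2)" for z Z
    unfolding wave_symbol_def quadric_def that[symmetric]
    by (simp add: sum_distrib_left sum_subtractf sum.distrib algebra_simps)
  \<comment> \<open>Conjugation makes the imaginary parts add. In the real parts the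
    \<open>b\<close> terms cancel, and the \<beta> of the zeroth-order term completes
    \<open>?s\<close> to the quadric of the Fourier domain.\<close>
  have "wave_symbol \<alpha> \<beta> a b \<xi> x - cnj (wave_symbol \<alpha> \<beta> a b \<xi> y)
      = \<i> * of_real ((\<Sum>m\<in>UNIV. 2 * \<alpha> $ m * a $ m * x $ m * \<xi> $ m) + (\<Sum>m\<in>UNIV. 2 * \<alpha> $ m * a $ m * y $ m * \<xi> $ m))
        - of_real (quadric \<alpha> \<beta> \<xi> * (X - Y))"
    unfolding symb[OF X_def] symb[OF Y_def] quadric_def by (simp add: algebra_simps)
  also have "\<dots> = (\<Sum>m\<in>UNIV. \<i> * of_real (a $ m * (x $ m + y $ m)) * (of_real (2 * \<alpha> $ m * \<xi> $ m)
        + of_real (quadric \<alpha> \<beta> \<xi>) * (\<i> * of_real ((x - y) $ m))))"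
    unfolding XY by (simp add: sum_distrib_left algebra_simps flip: sum.distrib sum_subtractf)
  finally show ?thesis .
qed

lemma continuous_on_wave_symbol:
  assumes "continuous_on T f" "continuous_on T g"
  shows "continuous_on T (\<lambda>p. wave_symbol \<alpha> \<beta> a b (f p) (g p))"
proof -
  have q: "continuous_on T (\<lambda>p. quadric a b (g p))"
    using continuous_on_compose2[OF continuous_on_quadric[of UNIV] assms(2)] by simp
  show ?thesis unfolding wave_symbol_def by (intro continuous_intros assms q)
qed

lemma continuous_on_plane_wave:
  assumes "continuous_on T f" "continuous_on T g"
  shows "continuous_on T (\<lambda>p. plane_wave (f p) (g p))"
  unfolding plane_wave_def by (intro continuous_intros assms)

text \<open>The factors \<open>a $ m * (x $ m + y $ m)\<close> do not depend on \<xi>, so each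
  summand of the symbol difference is a constant times an integrated total derivative. This is what
  makes the kernel \<open>k1\<close> below Hermitian.\<close>

lemma wave_symbol_integral_commute:
  fixes \<alpha> :: "real ^ 'd" and \<beta> :: real
  assumes \<alpha>: "\<And>m. \<alpha> $ m > 0"
  defines "F \<equiv> quadratic_domain 0 \<alpha> \<beta>"
  shows "(\<integral>\<xi>. wave_symbol \<alpha> \<beta> a b \<xi> x * plane_wave \<xi> (x - y) \<partial>lebesgue_on F)
    = (\<integral>\<xi>. cnj (wave_symbol \<alpha> \<beta> a b \<xi> y) * plane_wave \<xi> (x - y) \<partial>lebesgue_on F)"
proof -
  have F: "compact F" unfolding F_def using \<alpha> by (rule compact_quadratic_domain)
  have int: "integrable (lebesgue_on F) f" if "continuous_on F f" for f :: "real ^ 'd \<Rightarrow> complex"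
    using lmeasurable_compact[OF F] L2_continuous[OF F that] by (rule L2_integrable)
  have wc: "continuous_on T (\<lambda>\<xi>. plane_wave \<xi> z)" for T and z :: "real ^ 'd"
    by (intro continuous_on_plane_wave continuous_intros)
  have sc: "continuous_on T (\<lambda>\<xi>. wave_symbol \<alpha> \<beta> a b \<xi> z)" for T z
    by (intro continuous_on_wave_symbol continuous_intros)
  define z where "z = x - y"
  have h: "has_partials (\<lambda>\<xi>. plane_wave \<xi> z) (\<lambda>m \<xi>. \<i> * of_real (z $ m) * plane_wave \<xi> z)"
    using has_partials_plane_wave[of z] unfolding plane_wave_commute[of z] by (simp add: eta_contract_eq)
  have zero: "(\<integral>\<xi>. of_real (2 * \<alpha> $ m * \<xi> $ m) * plane_wave \<xi> z
      + of_real (quadric \<alpha> \<beta> \<xi>) * (\<i> * of_real (z $ m) * plane_wave \<xi> z) \<partial>lebesgue_on F) = 0" for m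
    unfolding F_def by (rule integral_partial_quadric[OF \<alpha> h]) (intro continuous_intros wc)
  have "(\<integral>\<xi>. wave_symbol \<alpha> \<beta> a b \<xi> x * plane_wave \<xi> z \<partial>lebesgue_on F)
      - (\<integral>\<xi>. cnj (wave_symbol \<alpha> \<beta> a b \<xi> y) * plane_wave \<xi> z \<partial>lebesgue_on F)
      = (\<integral>\<xi>. wave_symbol \<alpha> \<beta> a b \<xi> x * plane_wave \<xi> z
          - cnj (wave_symbol \<alpha> \<beta> a b \<xi> y) * plane_wave \<xi> z \<partial>lebesgue_on F)"
    by (intro Bochner_Integration.integral_diff[symmetric] int continuous_intros wc sc)
  also have "\<dots> = (\<integral>\<xi>. (\<Sum>m\<in>UNIV. \<i> * of_real (a $ m * (x $ m + y $ m)) * (of_real (2 * \<alpha> $ m * \<xi> $ m) * plane_wave \<xi> z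
        + of_real (quadric \<alpha> \<beta> \<xi>) * (\<i> * of_real (z $ m) * plane_wave \<xi> z))) \<partial>lebesgue_on F)"
  proof (intro Bochner_Integration.integral_cong refl)
    fix \<xi>
    have "wave_symbol \<alpha> \<beta> a b \<xi> x * plane_wave \<xi> z - cnj (wave_symbol \<alpha> \<beta> a b \<xi> y) * plane_wave \<xi> z
      = (wave_symbol \<alpha> \<beta> a b \<xi> x - cnj (wave_symbol \<alpha> \<beta> a b \<xi> y)) * plane_wave \<xi> z"
      by (rule left_diff_distrib[symmetric])
    also have "\<dots> = (\<Sum>m\<in>UNIV. \<i> * of_real (a $ m * (x $ m + y $ m)) * (of_real (2 * \<alpha> $ m * \<xi> $ m) * plane_wave \<xi> z
        + of_real (quadric \<alpha> \<beta> \<xi>) * (\<i> * of_real (z $ m) * plane_wave \<xi> z)))"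
      unfolding wave_symbol_diff sum_distrib_right z_def by (rule sum.cong) (simp_all only: ring_distribs mult.assoc)
    finally show "wave_symbol \<alpha> \<beta> a b \<xi> x * plane_wave \<xi> z - cnj (wave_symbol \<alpha> \<beta> a b \<xi> y) * plane_wave \<xi> z
      = (\<Sum>m\<in>UNIV. \<i> * of_real (a $ m * (x $ m + y $ m)) * (of_real (2 * \<alpha> $ m * \<xi> $ m) * plane_wave \<xi> z
        + of_real (quadric \<alpha> \<beta> \<xi>) * (\<i> * of_real (z $ m) * plane_wave \<xi> z)))" .
  qed
  also have "\<dots> = (\<Sum>m\<in>UNIV. \<integral>\<xi>. \<i> * of_real (a $ m * (x $ m + y $ m)) * (of_real (2 * \<alpha> $ m * \<xi> $ m) * plane_wave \<xi> z
        + of_real (quadric \<alpha> \<beta> \<xi>) * (\<i> * of_real (z $ m) * plane_wave \<xi> z)) \<partial>lebesgue_on F)"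
    by (intro Bochner_Integration.integral_sum int continuous_intros wc)
  also have "\<dots> = 0" using zero by simp
  finally show ?thesis by (simp add: z_def)
qed

section \<open>Commutation with the concentration operator\<close>

text \<open>Up to a constant, \<open>k0 x\<close> is the kernel with one variable frozen, and
  \<open>k1 x\<close> is the expression applied to it in the free variable. Symmetry of the
  realization moves the operator from \<open>f\<close> onto \<open>k0 x\<close>; Hermitian symmetry
  of \<open>k1\<close> then lets it act in the other variable, where it comes out of the
  integral.\<close>

lemma realization_commutes_with_concentration_operator:
  fixes a \<alpha> :: "real ^ 'd" and b \<beta> :: real
  assumes a: "\<And>m. a $ m > 0" and \<alpha>: "\<And>m. \<alpha> $ m > 0"
    and C: "C = (\<lambda>x. \<beta> * (\<Sum>n\<in>UNIV. a $ n * (x $ n)\<^sup>2))"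
  shows "commutes_with (realization \<alpha> a b C)
    (concentration_operator (quadratic_domain 0 a b) (quadratic_domain 0 \<alpha> \<beta>))"
proof -
  define S F where "S = quadratic_domain 0 a b" and "F = quadratic_domain 0 \<alpha> \<beta>"
  let ?T = "realization \<alpha> a b C"
  have Cc: "continuous_on UNIV C" unfolding C by (intro continuous_intros)
  have S: "compact S" and F: "compact F"
    unfolding S_def F_def using a \<alpha> by (auto intro: compact_quadratic_domain)
  have Sm: "S \<in> lmeasurable" and Fm: "F \<in> lmeasurable" using S F by (auto intro: lmeasurable_compact)
  interpret F: finite_measure "lebesgue_on F" using Fm by (rule finite_measure_lebesgue_on)
  have T_sym: "symmetric_graph S ?T" unfolding S_def by (rule realization_symmetric[OF a Cc])
  define D where "D = {(u, \<lambda>x. degenerate_laplacian \<alpha> a b u x + of_real (C x) * u x) | u.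
      u \<in> (\<Union>n. Collect (poly_lt n))}"
  have T: "?T = adjoint_graph S D" by (simp add: realization_def S_def D_def)
  have D: "D \<subseteq> L2 S \<times> L2 S"
    unfolding D_def S_def
    by (auto intro!: L2_add realization_mult_L2[OF a Cc]
        intro: poly_lt_L2[OF a Cc] degenerate_laplacian_poly_lt)
  let ?p = "wave_symbol \<alpha> \<beta> a b"

  obtain P where P: "\<And>\<xi> x. \<xi> \<in> F \<Longrightarrow> x \<in> S \<Longrightarrow> cmod (?p \<xi> x) \<le> P"
  proof -
    have "compact ((\<lambda>(\<xi>, x). ?p \<xi> x) ` (F \<times> S))"
      unfolding case_prod_unfold
      by (intro compact_continuous_image compact_Times F S continuous_on_wave_symbol continuous_intros)
    then obtain P where "\<forall>q\<in>(\<lambda>(\<xi>, x). ?p \<xi> x) ` (F \<times> S). cmod q \<le> P"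
      using compact_imp_bounded bounded_iff by meson
    then show ?thesis by (intro that[of P]) auto
  qed
  \<comment> \<open>One bound for the waves, of modulus 1, and for symbol times wave.\<close>
  define P' where "P' = max P 1"

  define k0 where "k0 = (\<lambda>x y. \<integral>\<xi>. cnj (plane_wave \<xi> x) * plane_wave \<xi> y \<partial>lebesgue_on F)"
  define k1 where "k1 = (\<lambda>x y. \<integral>\<xi>. cnj (plane_wave \<xi> x) * (?p \<xi> y * plane_wave \<xi> y) \<partial>lebesgue_on F)"

  note id = borel_measurable_ident_lebesgue_on
    and id2 = borel_measurable_ident_pair[OF borel_measurable_ident_lebesgue_on borel_measurable_ident_lebesgue_on]
  \<comment> \<open>A superposition of plane waves over the Fourier domain, with the conjugate wave
    at \<open>x\<close> as weight.\<close>
  have k_in_T: "(k0 x, k1 x) \<in> ?T" for x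
    unfolding k0_def k1_def T
  proof (rule adjoint_graph_superposition[OF D Sm F.finite_measure_axioms, where B = P'])
    show "(plane_wave \<xi>, \<lambda>y. ?p \<xi> y * plane_wave \<xi> y) \<in> adjoint_graph S D" for \<xi>
      using realization_C2[OF a Cc C2_plane_wave[of \<xi>], where \<alpha> = \<alpha> and b = b]
      unfolding T[symmetric] degenerate_laplacian_plane_wave[symmetric] C by (simp add: S_def)
    show "integrable (lebesgue_on F) (\<lambda>\<xi>. cnj (plane_wave \<xi> x))"
      by (intro L2_integrable Fm L2_continuous F continuous_intros continuous_on_plane_wave)
    show "(\<lambda>(y, \<xi>). plane_wave \<xi> y) \<in> borel_measurable (lebesgue_on S \<Otimes>\<^sub>M lebesgue_on F)"
      unfolding case_prod_unfold
      by (intro borel_measurable_continuous_ident[OF id2]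
          continuous_on_plane_wave continuous_intros)
    show "(\<lambda>(y, \<xi>). ?p \<xi> y * plane_wave \<xi> y) \<in> borel_measurable (lebesgue_on S \<Otimes>\<^sub>M lebesgue_on F)"
      unfolding case_prod_unfold
      by (intro borel_measurable_continuous_ident[OF id2]
          continuous_on_plane_wave continuous_on_wave_symbol continuous_intros)
    show "cmod (plane_wave \<xi> y) \<le> P'" for \<xi> y by (simp add: P'_def)
    show "cmod (?p \<xi> y * plane_wave \<xi> y) \<le> P'" if "\<xi> \<in> space (lebesgue_on F)" "y \<in> S" for \<xi> y
      using P[of \<xi> y] that by (simp add: norm_mult P'_def)
  qed

  have kbound: "cmod (\<integral>\<xi>. f \<xi> \<partial>lebesgue_on F) \<le> P' * measure lebesgue F"
    if "\<And>\<xi>. \<xi> \<in> F \<Longrightarrow> cmod (f \<xi>) \<le> P'" and "continuous_on F f" for f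
  proof -
    have "cmod (\<integral>\<xi>. f \<xi> \<partial>lebesgue_on F) \<le> (\<integral>\<xi>. P' \<partial>lebesgue_on F)"
      using that by (intro norm_integral_le_integral L2_integrable Fm L2_continuous F) auto
    then show ?thesis using Fm by (simp add: measure_restrict_space fmeasurable_def mult.commute)
  qed
  have k0_bound: "cmod (k0 x y) \<le> P' * measure lebesgue F" for x y
    unfolding k0_def
    by (rule kbound) (auto simp: norm_mult P'_def intro!: continuous_intros continuous_on_plane_wave)
  have k1_bound: "cmod (k1 x y) \<le> P' * measure lebesgue F" if "y \<in> S" for x y
    unfolding k1_def
  proof (rule kbound)
    show "cmod (cnj (plane_wave \<xi> x) * (?p \<xi> y * plane_wave \<xi> y)) \<le> P'" if "\<xi> \<in> F" for \<xi>
      using P[OF that \<open>y \<in> S\<close>] by (simp add: norm_mult P'_def)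
  qed (intro continuous_intros continuous_on_plane_wave continuous_on_wave_symbol)
  have km: "(\<lambda>(x, y). k0 y x) \<in> borel_measurable (lebesgue_on S \<Otimes>\<^sub>M lebesgue_on S)"
    "(\<lambda>(x, y). k1 y x) \<in> borel_measurable (lebesgue_on S \<Otimes>\<^sub>M lebesgue_on S)"
    unfolding k0_def k1_def case_prod_unfold
    by (rule F.borel_measurable_lebesgue_integral, unfold case_prod_unfold,
      intro borel_measurable_continuous_ident[OF borel_measurable_ident_pair[OF id2 id]]
          continuous_on_plane_wave continuous_on_wave_symbol continuous_intros)+

  define c where "c = 1 / complex_of_real ((2 * pi) ^ CARD('d))"
  have kernel: "concentration_kernel F (x - y) = c * k0 y x" for x y
    unfolding concentration_kernel_def c_def k0_def
    by (simp add: plane_wave_diff mult.commute flip: plane_wave_def)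
  have k0_cnj: "cnj (k0 x y) = k0 y x" for x y
    unfolding k0_def by (simp add: mult.commute flip: Bochner_Integration.integral_cnj)
  \<comment> \<open>Interchanging the variables moves the symbol from \<open>x\<close> to
    \<open>y\<close>, up to conjugation; this is where the geometry of the Fourier domain
    enters.\<close>
  have k1_cnj: "cnj (k1 x y) = k1 y x" for x y
  proof -
    have "cnj (k1 x y) = (\<integral>\<xi>. cnj (?p \<xi> y) * plane_wave \<xi> (x - y) \<partial>lebesgue_on F)"
      unfolding k1_def plane_wave_diff by (simp add: mult_ac flip: Bochner_Integration.integral_cnj)
    also have "\<dots> = (\<integral>\<xi>. ?p \<xi> x * plane_wave \<xi> (x - y) \<partial>lebesgue_on F)"
      unfolding F_def by (rule wave_symbol_integral_commute[OF \<alpha>, symmetric])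
    also have "\<dots> = k1 y x" unfolding k1_def plane_wave_diff by (simp add: mult_ac)
    finally show ?thesis .
  qed

  have "(concentration_operator S F f, concentration_operator S F g) \<in> ?T" if fg: "(f, g) \<in> ?T" for f g
  proof -
    have L: "f \<in> L2 S" "g \<in> L2 S" using fg adjoint_graph_D(1,2) unfolding T by blast+
    have Kf: "concentration_operator S F f = (\<lambda>x. \<integral>y. (c * f y) * k0 y x \<partial>lebesgue_on S)"
      unfolding concentration_operator_def kernel by (simp add: mult_ac)
    have Kg: "concentration_operator S F g = (\<lambda>x. \<integral>y. (c * f y) * k1 y x \<partial>lebesgue_on S)"
    proof
      fix x
      have "L2_inner S g (k0 x) = L2_inner S f (k1 x)"
        by (rule symmetric_graphD[OF T_sym fg k_in_T])
      then have "c * (\<integral>y. g y * k0 y x \<partial>lebesgue_on S) = c * (\<integral>y. f y * k1 y x \<partial>lebesgue_on S)"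
        unfolding L2_inner_def k0_cnj k1_cnj by simp
      then show "concentration_operator S F g x = (\<integral>y. (c * f y) * k1 y x \<partial>lebesgue_on S)"
        unfolding concentration_operator_def kernel by (simp add: mult_ac)
    qed
    \<comment> \<open>Second superposition, now of the pairs (k0 y, k1 y) over the space domain with
      weight \<open>c * f y\<close>.\<close>
    show ?thesis
      unfolding Kf Kg T
    proof (rule adjoint_graph_superposition[OF D Sm finite_measure_lebesgue_on[OF Sm]])
      show "(k0 y, k1 y) \<in> adjoint_graph S D" for y using k_in_T unfolding T .
      show "integrable (lebesgue_on S) (\<lambda>y. c * f y)" using L2_integrable[OF Sm L(1)] by simp
    qed (use km k0_bound k1_bound in auto)
  qed
  then show ?thesis unfolding commutes_with_def S_def F_def by blast
qed

theorem proposition2: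
  fixes a \<alpha> :: "real ^ 'd" and b \<beta> :: real
    and \<Omega>S \<Omega>F :: "(real ^ 'd) set"
    and A :: "real ^ 'd \<Rightarrow> real ^ 'd ^ 'd" and C :: "real ^ 'd \<Rightarrow> real"
  assumes "\<Omega>S = quadratic_domain 0 a b"
    and "\<Omega>F = quadratic_domain 0 \<alpha> \<beta>"
    and "indicator \<Omega>S \<in> L2 UNIV"
    and "indicator \<Omega>F \<in> L2 UNIV"
    and "\<And>x. A x = diag (\<chi> m. \<alpha> $ m * ((\<Sum>n\<in>UNIV. a $ n * (x $ n)\<^sup>2) - b))"
    and "\<And>x. C x = \<beta> * (x \<bullet> (diag a *v x))"
  shows "\<exists>P. self_adjoint \<Omega>S P \<and> realizes \<Omega>S A C P \<and>
             commutes_with P (concentration_operator \<Omega>S \<Omega>F)"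
proof (cases "negligible \<Omega>S")
  case True
  have L2: "f \<in> L2 \<Omega>S" for f using L2_negligible[OF True] .
  have inner: "L2_inner \<Omega>S f g = 0" for f g
    unfolding L2_inner_def by (rule integral_lebesgue_on_negligible[OF True])
  have norm: "L2_norm \<Omega>S f = 0" for f
    using L2_inner_self[of \<Omega>S f] by (simp add: inner)
  have ae: "ae_eq \<Omega>S f g" for f g
    using L2_norm_eq_0_D[OF L2 norm, of "\<lambda>x. f x - g x"] by (simp add: ae_eq_def)
  \<comment> \<open>On a null set L2 has a single class, so the full relation is the graph of the
    zero operator.\<close>
  have "self_adjoint \<Omega>S UNIV"
    unfolding self_adjoint_def L2_operator_def densely_defined_def adjoint_graph_def
    using L2 by (auto simp: inner norm ae)
  moreover have "realizes \<Omega>S A C UNIV"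
    unfolding realizes_def by (auto simp: integral_lebesgue_on_negligible[OF True])
  ultimately show ?thesis unfolding commutes_with_def by blast
next
  case False
  have a: "a $ m > 0" for m
    using quadratic_domain_negligible_or_pos[OF quadratic_domain_lmeasurable] assms(1,3) False by blast
  have C: "C = (\<lambda>x. \<beta> * (\<Sum>n\<in>UNIV. a $ n * (x $ n)\<^sup>2))"
    using assms(6) by (simp add: fun_eq_iff diag_quadratic_form)
  have Cc: "continuous_on UNIV C" unfolding C by (intro continuous_intros)
  have A: "A x = diag (\<chi> m. \<alpha> $ m * quadric a b x)" for x
    by (simp add: assms(5) quadric_def)
  have At: "transpose (A x) = A x" for x by (simp add: A transpose_diag)
  let ?T = "realization \<alpha> a b C"
  have sa: "self_adjoint \<Omega>S ?T" unfolding assms(1) using a Cc by (rule realization_self_adjoint)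
  have T_sym: "symmetric_graph \<Omega>S ?T" unfolding assms(1) using a Cc by (rule realization_symmetric)
  have C2T: "(f, divergence_form A C f) \<in> ?T" if "C2 f" for f
    unfolding divergence_form_eq[OF A that] using a Cc that by (rule realization_C2)
  \<comment> \<open>The distributional identity pairs bilinearly, whereas symmetry concerns the
    sesquilinear inner product. Since the coefficients are real, conjugating the test function
    passes from one to the other.\<close>
  have C2_cnj: "C2 (\<lambda>x. cnj (\<phi> x))"
    and form_cnj: "divergence_form A C (\<lambda>x. cnj (\<phi> x)) = (\<lambda>x. cnj (divergence_form A C \<phi> x))"
    if \<phi>: "C2 \<phi>" for \<phi>
  proof -
    note p1 = has_partials_cnj[OF C2_D(1)[OF \<phi>]] and p2 = has_partials_cnj[OF C2_D(2)[OF \<phi>]]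
    show *: "C2 (\<lambda>x. cnj (\<phi> x))"
      by (rule C2_I[OF p1 p2]) (intro continuous_intros C2_D(3) \<phi>)
    show "divergence_form A C (\<lambda>x. cnj (\<phi> x)) = (\<lambda>x. cnj (divergence_form A C \<phi> x))"
      unfolding divergence_form_eq[OF A *] divergence_form_eq[OF A \<phi>] degenerate_laplacian_def
        has_partials_unique[OF p1] has_partials_unique[OF p2] by simp
  qed
  have "(\<integral>x. g x * \<phi> x \<partial>lebesgue_on \<Omega>S) = (\<integral>x. f x * divergence_form A C \<phi> x \<partial>lebesgue_on \<Omega>S)"
    if "(f, g) \<in> ?T" "C2 \<phi>" for f g \<phi>
    using symmetric_graphD[OF T_sym that(1) C2T[OF C2_cnj[OF that(2)]]]
    by (simp add: L2_inner_def form_cnj[OF that(2)])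
  then have "realizes \<Omega>S A C ?T"
    unfolding realizes_def At using C2T by blast
  moreover have "commutes_with ?T (concentration_operator \<Omega>S \<Omega>F)"
  proof (cases "negligible \<Omega>F")
    case True
    have "concentration_operator \<Omega>S \<Omega>F f = (\<lambda>x. 0)" for f
      unfolding concentration_operator_def concentration_kernel_def
      by (simp add: integral_lebesgue_on_negligible[OF True])
    moreover have "(\<lambda>x. 0, \<lambda>x. 0) \<in> ?T"
      using sa by (simp add: self_adjoint_def L2_operator_def)
    ultimately show ?thesis by (auto simp: commutes_with_def)
  next
    case False
    have \<alpha>: "\<alpha> $ m > 0" for m
      using quadratic_domain_negligible_or_pos[OF quadratic_domain_lmeasurable] assms(2,4) False by blast
    show ?thesis
      unfolding assms(1,2) by (rule realization_commutes_with_concentration_operator[OF a \<alpha> C])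
  qed
  ultimately show ?thesis using sa by blast
qed

end
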